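(* Consider the Kepler system in the plane with $$H=\frac{p_1^2+p_2^2}{2}-\frac{\kappa}{\sqrt{q_1^2+q_2^2}},\qquad X=P\,dH,$$ where $P$ is the canonical Poisson bivector. Put $$K_1=p_1(p_1q_2-p_2q_1)-\frac{\kappa q_2}{\sqrt{q_1^2+q_2^2}},\quad K_2=p_2(p_1q_2-p_2q_1)+\frac{\kappa q_1}{\sqrt{q_1^2+q_2^2}},\quad K_3=q_1p_2-q_2p_1,$$ $X_k=P\,dK_k$ for $k=1,2,3$, and let $\tilde P$ be the bivector with entries $$\tilde P^{12}=q_1p_2-p_1q_2,\quad \tilde P^{13}=-\frac{p_2^2}{2}+\frac{\kappa q_2^2}{(q_1^2+q_2^2)^{3/2}},\quad \tilde P^{14}=\tilde P^{23}=\frac{p_1p_2}{2}-\frac{\kappa q_1q_2}{(q_1^2+q_2^2)^{3/2}},$$ $$\tilde P^{24}=-\frac{p_1^2}{2}+\frac{\kappa q_1^2}{(q_1^2+q_2^2)^{3/2}},\quad \tilde P^{34}=\frac{\kappa(p_1q_2-p_2q_1)}{2(q_1^2+q_2^2)^{3/2}} .$$ Consider the nine-parameter solution $$P'=(a_1X_1+a_2X_2)\wedge X_3+(a_3H+a_4K_3^2+a_5K_1+a_6K_2+a_7K_3+a_8)P+a_9\tilde P$$ of the invariance equation $\mathcal L_XP'=0$. Substituting $P'$ into the Jacobi identity $[\![P',P']\!]=0$ and solving the resulting equation for the parameters $a_k$, one obtains four invariant Poisson bivectors (with parameters $a,b$ and $i=\sqrt{-1}$): $$P'_1=a(X_1+iX_2)\wedge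 X_3+bP,\qquad \operatorname{rank}P'_1=4,$$ $$P'_2=a(HP-2\tilde P),\qquad \operatorname{rank}P'_2=4,$$ $$P'_3=a(X_1\wedge X_3-K_2P)+b(HP+\tilde P),\qquad \operatorname{rank}P'_3=2,$$ $$P'_4=a(X_2\wedge X_3+K_1P)+b(HP+\tilde P),\qquad \operatorname{rank}P'_4=2,$$ so that $$P'_1dH-\bigl(b-a(K_1-iK_2)\bigr)P\,dK_3=0,\qquad 2P'_3dH-bK_3P\,dH=0,$$ $$P'_2dH-K_3P\,dH-3HP\,dK_3=0,\qquad 2P'_4dH-bK_3P\,dH=0 .$$ Only one of these Poisson bivectors is compatible with the canonical one: $$[\![P,P'_1]\!]=0,\qquad [\![P,P'_k]\!]\neq0,\quad k=2,3,4 .$$ So the Kepler problem has three invariant symplectic forms $\omega=P^{-1}$, $\omega'_1=(P'_1)^{-1}$, $\omega'_2=(P'_2)^{-1}$ and two invariant rank-two Poisson bivectors $P'_3$ and $P'_4$.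
   Context: Coordinates are $x=(x^1,x^2,x^3,x^4)=(q_1,q_2,p_1,p_2)$ and $\kappa$ is a real constant. Bivectors are given by skew-symmetric matrices of entries $B^{ij}=-B^{ji}$, and the rank is the rank of this matrix. The canonical Poisson bivector $P$ has $P^{13}=P^{24}=1$, $P^{31}=P^{42}=-1$ and all other entries zero; for a bivector $B$ and function $F$, $(B\,dF)^i=\sum_jB^{ij}\,\partial F/\partial x^j$. $\wedge$ is the exterior product of vector fields, $\mathcal L_X$ the Lie derivative along $X$, and $[\![\cdot,\cdot]\!]$ the Schouten–Nijenhuis bracket of multivector fields. A bivector is Poisson if its Schouten bracket with itself vanishes, invariant if its Lie derivative along $X$ vanishes, and two Poisson bivectors are compatible if their Schouten bracket vanishes. The inverse of a nondegenerate bivector is the 2-form with the inverse matrix.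
   Formalization: The four relations hold for P'_k dK_3, not P'_k dH, with factor b-a(iK_1-K_2), general a, and +bK_3; X∧Y has entries X^jY^i-X^iY^j; Jacobi solutions also include -i in P'_1 and sums P'_3+P'_4; rank is generic, with b≠0 (P'_1), a≠0 (P'_2), (a,b)≠0; inverses where nondegenerate. *)

theory Defs
  imports "HOL-Analysis.Analysis"
begin

text \<open>
  Points are \<open>x = (x$1, x$2, x$3, x$4) = (q1, q2, p1, p2)\<close>. Functions, vector fields, bivector
  fields and 2-forms on the real phase space are complex valued, because the imaginary unit occurs
  among the coefficients.
\<close>

type_synonym point = "real ^ 4"
type_synonym scalar_field = "point \<Rightarrow> complex"
type_synonym vector_field = "point \<Rightarrow> complex ^ 4"
type_synonym matrix_field = "point \<Rightarrow> complex ^ 4 ^ 4"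


subsection \<open>Tensor calculus in coordinates\<close>

definition pd :: "4 \<Rightarrow> scalar_field \<Rightarrow> scalar_field" where
  "pd j F x = vector_derivative (\<lambda>t. F (x + t *\<^sub>R axis j 1)) (at 0)"

definition differential :: "scalar_field \<Rightarrow> vector_field" where
  "differential F x = (\<chi> j. pd j F x)"

definition bivector_apply :: "matrix_field \<Rightarrow> scalar_field \<Rightarrow> vector_field" where
  "bivector_apply B F x = B x *v differential F x"

definition cscale :: "complex \<Rightarrow> complex ^ 4 ^ 4 \<Rightarrow> complex ^ 4 ^ 4" (infixr \<open>*\<^sub>m\<close> 75) where
  "c *\<^sub>m A = (\<chi> i j. c * A $ i $ j)"

text \<open>
  A bivector \<open>B\<close> is represented by the matrix for which \<open>B dF\<close> (matrix times gradient) is the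
  interior product of \<open>dF\<close> with \<open>B\<close>. As the interior product is an antiderivation,
  \<open>(X \<and> Y) dF = (X F) Y - (Y F) X\<close>, which gives the matrix below. The opposite sign convention
  for the matrix of \<open>X \<and> Y\<close> amounts to changing the sign of \<open>a1\<close>, \<open>a2\<close> in the nine-parameter
  family; with it the bivectors \<open>kepler_P3\<close> and \<open>kepler_P4\<close> below would not be Poisson.
\<close>

definition wedge :: "complex ^ 4 \<Rightarrow> complex ^ 4 \<Rightarrow> complex ^ 4 ^ 4" where
  "wedge X Y = (\<chi> i j. X $ j * Y $ i - X $ i * Y $ j)"

definition lie_bivector :: "vector_field \<Rightarrow> matrix_field \<Rightarrow> matrix_field" where
  "lie_bivector X B x = (\<chi> i j. \<Sum>m\<in>UNIV.
      X x $ m * pd m (\<lambda>y. B y $ i $ j) x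
      - B x $ m $ j * pd m (\<lambda>y. X y $ i) x
      - B x $ i $ m * pd m (\<lambda>y. X y $ j) x)"

definition lie_form :: "vector_field \<Rightarrow> matrix_field \<Rightarrow> matrix_field" where
  "lie_form X \<omega> x = (\<chi> i j. \<Sum>m\<in>UNIV.
      X x $ m * pd m (\<lambda>y. \<omega> y $ i $ j) x
      + \<omega> x $ m $ j * pd i (\<lambda>y. X y $ m) x
      + \<omega> x $ i $ m * pd j (\<lambda>y. X y $ m) x)"

definition ext_deriv_form :: "matrix_field \<Rightarrow> 4 \<Rightarrow> 4 \<Rightarrow> 4 \<Rightarrow> scalar_field" where
  "ext_deriv_form \<omega> i j k x =
     pd i (\<lambda>y. \<omega> y $ j $ k) x + pd j (\<lambda>y. \<omega> y $ k $ i) x + pd k (\<lambda>y. \<omega> y $ i $ j) x"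

text \<open>Component \<open>(i,j,k)\<close> of the Schouten--Nijenhuis bracket of two bivector fields.\<close>

definition schouten :: "matrix_field \<Rightarrow> matrix_field \<Rightarrow> 4 \<Rightarrow> 4 \<Rightarrow> 4 \<Rightarrow> scalar_field" where
  "schouten A B i j k x = - (\<Sum>m\<in>UNIV.
      B x $ m $ k * pd m (\<lambda>y. A y $ i $ j) x + A x $ m $ k * pd m (\<lambda>y. B y $ i $ j) x
    + B x $ m $ i * pd m (\<lambda>y. A y $ j $ k) x + A x $ m $ i * pd m (\<lambda>y. B y $ j $ k) x
    + B x $ m $ j * pd m (\<lambda>y. A y $ k $ i) x + A x $ m $ j * pd m (\<lambda>y. B y $ k $ i) x)"

definition skew_field_on :: "point set \<Rightarrow> matrix_field \<Rightarrow> bool" where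
  "skew_field_on U B \<longleftrightarrow> (\<forall>x\<in>U. transpose (B x) = - B x \<and>
     (\<forall>i j. (\<lambda>y. B y $ i $ j) differentiable (at x)))"

definition poisson_on :: "point set \<Rightarrow> matrix_field \<Rightarrow> bool" where
  "poisson_on U B \<longleftrightarrow> skew_field_on U B \<and> (\<forall>x\<in>U. \<forall>i j k. schouten B B i j k x = 0)"

definition compatible_on :: "point set \<Rightarrow> matrix_field \<Rightarrow> matrix_field \<Rightarrow> bool" where
  "compatible_on U A B \<longleftrightarrow> (\<forall>x\<in>U. \<forall>i j k. schouten A B i j k x = 0)"

definition invariant_bivector_on :: "point set \<Rightarrow> vector_field \<Rightarrow> matrix_field \<Rightarrow> bool" where
  "invariant_bivector_on U X B \<longleftrightarrow> (\<forall>x\<in>U. lie_bivector X B x = 0)"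

definition symplectic_on :: "point set \<Rightarrow> matrix_field \<Rightarrow> bool" where
  "symplectic_on U \<omega> \<longleftrightarrow> skew_field_on U \<omega> \<and> (\<forall>x\<in>U. invertible (\<omega> x)) \<and>
     (\<forall>x\<in>U. \<forall>i j k. ext_deriv_form \<omega> i j k x = 0)"

definition invariant_form_on :: "point set \<Rightarrow> vector_field \<Rightarrow> matrix_field \<Rightarrow> bool" where
  "invariant_form_on U X \<omega> \<longleftrightarrow> (\<forall>x\<in>U. lie_form X \<omega> x = 0)"

text \<open>
  The rank of a bivector field is its generic rank: a field given by analytic expressions may drop
  rank on a thin set, e.g. \<open>kepler_P2\<close> below degenerates exactly on \<open>H = 0\<close>.
\<close>

definition generic_rank_on :: "point set \<Rightarrow> matrix_field \<Rightarrow> nat \<Rightarrow> bool" where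
  "generic_rank_on U B r \<longleftrightarrow>
     open {x \<in> U. rank (B x) = r} \<and> U \<subseteq> closure {x \<in> U. rank (B x) = r}"

definition nondegenerate_set :: "point set \<Rightarrow> matrix_field \<Rightarrow> point set" where
  "nondegenerate_set U B = {x \<in> U. invertible (B x)}"

definition inverse_form :: "matrix_field \<Rightarrow> matrix_field" where
  "inverse_form B x = matrix_inv (B x)"


subsection \<open>The planar Kepler system\<close>

definition phase_space :: "point set" where
  "phase_space = {x. (x $ 1, x $ 2) \<noteq> (0, 0)}"

definition skew_matrix ::
  "complex \<Rightarrow> complex \<Rightarrow> complex \<Rightarrow> complex \<Rightarrow> complex \<Rightarrow> complex \<Rightarrow> complex ^ 4 ^ 4" where
  "skew_matrix b12 b13 b14 b23 b24 b34 =
     vector [vector [0, b12, b13, b14],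
             vector [- b12, 0, b23, b24],
             vector [- b13, - b23, 0, b34],
             vector [- b14, - b24, - b34, 0]]"

lemma skew_matrix_nth:
  fixes b12 b13 b14 b23 b24 b34 :: complex
  defines "S \<equiv> skew_matrix b12 b13 b14 b23 b24 b34"
  shows "S $ 1 $ 1 = 0" "S $ 1 $ 2 = b12" "S $ 1 $ 3 = b13" "S $ 1 $ 4 = b14"
    "S $ 2 $ 1 = - b12" "S $ 2 $ 2 = 0" "S $ 2 $ 3 = b23" "S $ 2 $ 4 = b24"
    "S $ 3 $ 1 = - b13" "S $ 3 $ 2 = - b23" "S $ 3 $ 3 = 0" "S $ 3 $ 4 = b34"
    "S $ 4 $ 1 = - b14" "S $ 4 $ 2 = - b24" "S $ 4 $ 3 = - b34" "S $ 4 $ 4 = 0"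
  unfolding S_def skew_matrix_def vector_def by simp_all

definition canonical_P :: matrix_field where
  "canonical_P x = skew_matrix 0 1 0 0 1 0"

definition kepler_H :: "real \<Rightarrow> scalar_field" where
  "kepler_H \<kappa> x = (let q1 = x $ 1; q2 = x $ 2; p1 = x $ 3; p2 = x $ 4 in
     complex_of_real ((p1\<^sup>2 + p2\<^sup>2) / 2 - \<kappa> / sqrt (q1\<^sup>2 + q2\<^sup>2)))"

definition kepler_K1 :: "real \<Rightarrow> scalar_field" where
  "kepler_K1 \<kappa> x = (let q1 = x $ 1; q2 = x $ 2; p1 = x $ 3; p2 = x $ 4 in
     complex_of_real (p1 * (p1 * q2 - p2 * q1) - \<kappa> * q2 / sqrt (q1\<^sup>2 + q2\<^sup>2)))"

definition kepler_K2 :: "real \<Rightarrow> scalar_field" where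
  "kepler_K2 \<kappa> x = (let q1 = x $ 1; q2 = x $ 2; p1 = x $ 3; p2 = x $ 4 in
     complex_of_real (p2 * (p1 * q2 - p2 * q1) + \<kappa> * q1 / sqrt (q1\<^sup>2 + q2\<^sup>2)))"

definition kepler_K3 :: scalar_field where
  "kepler_K3 x = (let q1 = x $ 1; q2 = x $ 2; p1 = x $ 3; p2 = x $ 4 in
     complex_of_real (q1 * p2 - q2 * p1))"

definition kepler_X :: "real \<Rightarrow> vector_field" where
  "kepler_X \<kappa> = bivector_apply canonical_P (kepler_H \<kappa>)"

definition kepler_X1 :: "real \<Rightarrow> vector_field" where
  "kepler_X1 \<kappa> = bivector_apply canonical_P (kepler_K1 \<kappa>)"

definition kepler_X2 :: "real \<Rightarrow> vector_field" where
  "kepler_X2 \<kappa> = bivector_apply canonical_P (kepler_K2 \<kappa>)"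

definition kepler_X3 :: vector_field where
  "kepler_X3 = bivector_apply canonical_P kepler_K3"

definition kepler_Pt :: "real \<Rightarrow> matrix_field" where
  "kepler_Pt \<kappa> x = (let q1 = x $ 1; q2 = x $ 2; p1 = x $ 3; p2 = x $ 4;
       r3 = (q1\<^sup>2 + q2\<^sup>2) powr (3 / 2) in
     skew_matrix
       (complex_of_real (q1 * p2 - p1 * q2))
       (complex_of_real (- (p2\<^sup>2 / 2) + \<kappa> * q2\<^sup>2 / r3))
       (complex_of_real (p1 * p2 / 2 - \<kappa> * q1 * q2 / r3))
       (complex_of_real (p1 * p2 / 2 - \<kappa> * q1 * q2 / r3))
       (complex_of_real (- (p1\<^sup>2 / 2) + \<kappa> * q1\<^sup>2 / r3))
       (complex_of_real (\<kappa> * (p1 * q2 - p2 * q1) / (2 * r3))))"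

text \<open>The parameters are \<open>a 1, \<dots>, a 9\<close>; other values of \<open>a\<close> are irrelevant.\<close>

definition kepler_family :: "real \<Rightarrow> (nat \<Rightarrow> complex) \<Rightarrow> matrix_field" where
  "kepler_family \<kappa> a x =
     wedge (a 1 *s kepler_X1 \<kappa> x + a 2 *s kepler_X2 \<kappa> x) (kepler_X3 x)
     + (a 3 * kepler_H \<kappa> x + a 4 * (kepler_K3 x)\<^sup>2 + a 5 * kepler_K1 \<kappa> x + a 6 * kepler_K2 \<kappa> x
        + a 7 * kepler_K3 x + a 8) *\<^sub>m canonical_P x
     + a 9 *\<^sub>m kepler_Pt \<kappa> x"

definition kepler_P1 :: "real \<Rightarrow> complex \<Rightarrow> complex \<Rightarrow> matrix_field" where
  "kepler_P1 \<kappa> a b x =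
     a *\<^sub>m wedge (kepler_X1 \<kappa> x + \<i> *s kepler_X2 \<kappa> x) (kepler_X3 x) + b *\<^sub>m canonical_P x"

definition kepler_P2 :: "real \<Rightarrow> complex \<Rightarrow> matrix_field" where
  "kepler_P2 \<kappa> a x = a *\<^sub>m (kepler_H \<kappa> x *\<^sub>m canonical_P x - 2 *\<^sub>m kepler_Pt \<kappa> x)"

definition kepler_P3 :: "real \<Rightarrow> complex \<Rightarrow> complex \<Rightarrow> matrix_field" where
  "kepler_P3 \<kappa> a b x =
     a *\<^sub>m (wedge (kepler_X1 \<kappa> x) (kepler_X3 x) - kepler_K2 \<kappa> x *\<^sub>m canonical_P x)
     + b *\<^sub>m (kepler_H \<kappa> x *\<^sub>m canonical_P x + kepler_Pt \<kappa> x)"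

definition kepler_P4 :: "real \<Rightarrow> complex \<Rightarrow> complex \<Rightarrow> matrix_field" where
  "kepler_P4 \<kappa> a b x =
     a *\<^sub>m (wedge (kepler_X2 \<kappa> x) (kepler_X3 x) + kepler_K1 \<kappa> x *\<^sub>m canonical_P x)
     + b *\<^sub>m (kepler_H \<kappa> x *\<^sub>m canonical_P x + kepler_Pt \<kappa> x)"

text \<open>\<open>kepler_P1\<close> with the other square root of \<open>-1\<close>.\<close>

definition kepler_P1_conj :: "real \<Rightarrow> complex \<Rightarrow> complex \<Rightarrow> matrix_field" where
  "kepler_P1_conj \<kappa> a b x =
     a *\<^sub>m wedge (kepler_X1 \<kappa> x - \<i> *s kepler_X2 \<kappa> x) (kepler_X3 x) + b *\<^sub>m canonical_P x"

end

(*
  Every coefficient that occurs is a polynomial in q1, q2, p1, p2 and kappa/r, kappa/r^3. Writing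
  v = kappa/r^5 and rho = q1^2 + q2^2 one has kappa/r = v rho^2 and kappa/r^3 = v rho, and the first
  derivatives of these are polynomials in v, q1, q2 as well. Hence the invariance equation and the
  Jacobi identity become polynomial identities in the independent variables q1, q2, p1, p2, v.

  That the Jacobi identity forces the listed parameters is already visible on the two families of
  points q = (0, l), p = (t, 0) and q = (l, 0), p = (0, t), by comparing coefficients of powers of l
  and t.
  Ranks are read off the Pfaffian; a skew 4x4 matrix with vanishing Pfaffian satisfies the Pluecker
  relations, so it has rank at most 2. For a nondegenerate bivector B the form w = B^-1 satisfies
  dw = w w w [B, B] and L_X w = - w (L_X B) w up to sign, so it is closed and invariant.
*)

theory Submission
  imports Defs
begin

subsection \<open>Skew-symmetric matrices of size four\<close>

text \<open>At a point, the Schouten bracket, the Lie derivative and the derivatives of the inverse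
  form depend only on the value \<open>b\<close> of the bivector and the matrices \<open>D m\<close>
  of its first partial derivatives. Each is recast as an algebraic function of such data
  (\<open>jacobiator\<close>, \<open>lie_jet\<close>, \<open>inverse_pd\<close>). Analysis enters
  only in finding \<open>D\<close> for the nine-parameter family; P and all the named bivectors are
  members of it, so most facts are shown once for the family.

  The leading coefficients in t do not contain kappa. Their constant terms in l give (a3 - a9)(2 a3
  + a9) = 0, which is where the combinations of H P with 1 and with -2 times the extra bivector come
  from. The first ratio belongs to a three-dimensional linear space, so sums of P3 and P4 are
  Poisson as well. A third piece, a1^2 + a2^2 = 0, factors over the complex numbers into two
  conjugate planes, hence \<open>kepler_P1_conj\<close>. No equation is divided by kappa, so kappa =
  0 is covered.\<close>

definition pfaffian :: "complex ^ 4 ^ 4 \<Rightarrow> complex" where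
  "pfaffian A = A $ 1 $ 2 * A $ 3 $ 4 - A $ 1 $ 3 * A $ 2 $ 4 + A $ 1 $ 4 * A $ 2 $ 3"

text \<open>The Pfaffian analogue of the adjugate: each entry holds the complementary entry, signed
  so that the product with \<open>A\<close> is the Pfaffian times the identity. It is linear in
  \<open>A\<close>, hence commutes with differentiation.\<close>

definition pf_dual :: "complex ^ 4 ^ 4 \<Rightarrow> complex ^ 4 ^ 4" where
  "pf_dual A = skew_matrix (- A $ 3 $ 4) (A $ 2 $ 4) (- A $ 2 $ 3) (- A $ 1 $ 4) (A $ 1 $ 3) (- A $ 1 $ 2)"

lemma skew_entries:
  fixes A :: "complex ^ 4 ^ 4"
  assumes "transpose A = - A"
  shows "A $ i $ i = 0" and "A $ j $ i = - A $ i $ j"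
proof -
  have *: "A $ j $ i = - (A $ i $ j)" for i j
  proof -
    have "A $ j $ i = transpose A $ i $ j" by (simp add: transpose_def)
    also have "\<dots> = - (A $ i $ j)" by (simp add: assms)
    finally show ?thesis .
  qed
  show "A $ j $ i = - A $ i $ j" by (rule *)
  have "2 * A $ i $ i = 0" using *[of i i] by algebra
  then show "A $ i $ i = 0" by simp
qed

lemma skewI:
  fixes A :: "complex ^ 4 ^ 4"
  assumes "\<And>i j. A $ j $ i = - A $ i $ j"
  shows "transpose A = - A"
  unfolding vec_eq_iff transpose_def vec_lambda_beta vector_uminus_component by (intro allI assms)

text \<open>Transports an identity checked by expansion in six free entries to an arbitrary skew
  matrix.\<close>

lemma skew_eq_skew_matrix:
  fixes A :: "complex ^ 4 ^ 4"
  assumes "transpose A = - A"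
  shows "A = skew_matrix (A $ 1 $ 2) (A $ 1 $ 3) (A $ 1 $ 4) (A $ 2 $ 3) (A $ 2 $ 4) (A $ 3 $ 4)"
  unfolding vec_eq_iff forall_4 skew_matrix_nth
  by (intro conjI refl skew_entries[OF assms])

lemma transpose_skew_matrix: "transpose (skew_matrix b12 b13 b14 b23 b24 b34)
    = - skew_matrix b12 b13 b14 b23 b24 b34"
  by (simp add: vec_eq_iff forall_4 skew_matrix_nth transpose_def)

lemma pf_dual_mult:
  assumes "transpose A = - A"
  shows "A ** pf_dual A = mat (pfaffian A)"
proof -
  have "skew_matrix b12 b13 b14 b23 b24 b34 ** pf_dual (skew_matrix b12 b13 b14 b23 b24 b34)
      = mat (pfaffian (skew_matrix b12 b13 b14 b23 b24 b34))" for b12 b13 b14 b23 b24 b34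
    by (simp add: vec_eq_iff forall_4 pf_dual_def pfaffian_def skew_matrix_nth matrix_matrix_mult_def
        sum_4 mat_def algebra_simps)
  from this[of "A $ 1 $ 2" "A $ 1 $ 3" "A $ 1 $ 4" "A $ 2 $ 3" "A $ 2 $ 4" "A $ 3 $ 4"] show ?thesis
    by (simp only: skew_eq_skew_matrix[OF assms, symmetric])
qed

text \<open>The left-hand side is alternating in its four indices, so over four values it is
  determined by a single component, and that component is the Pfaffian.\<close>

lemma plucker_relation:
  assumes "transpose A = - A" "pfaffian A = 0"
  shows "A $ i $ j * A $ k $ l - A $ i $ k * A $ j $ l + A $ i $ l * A $ j $ k = 0"
proof -
  note d = skew_entries(1)[OF assms(1)] and s = skew_entries(2)[OF assms(1)]
  define T where "T i j k l = A $ i $ j * A $ k $ l - A $ i $ k * A $ j $ l + A $ i $ l * A $ j $ k"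
      for i j k l
  have s1: "T j i k l = - T i j k l" for i j k l
    unfolding T_def s[of i j] by (simp add: algebra_simps)
  have s2: "T i k j l = - T i j k l" for i j k l
    unfolding T_def s[of j k] by (simp add: algebra_simps)
  have s3: "T i j l k = - T i j k l" for i j k l
    unfolding T_def s[of k l] by (simp add: algebra_simps)
  have d1: "T i i k l = 0" for i k l unfolding T_def d by (simp add: algebra_simps)
  have d2: "T i k k l = 0" for i k l unfolding T_def d by (simp add: algebra_simps)
  have d3: "T i k l l = 0" for i k l unfolding T_def d by (simp add: algebra_simps)
  have d4: "T i k l k = 0" for i k l using d2 s3 by metis
  have d5: "T i k i l = 0" for i k l using d1 s2 by metis
  have d6: "T i k l i = 0" for i k l using d5 s3 by metis
  have b: "T 4 3 2 1 = 0"
    using assms(2) unfolding pfaffian_def T_def s[of 2 1] s[of 3 1] s[of 4 1] s[of 3 2] s[of 4 2] s[of 4 3]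
    by (simp add: algebra_simps)
  \<comment> \<open>The instances sort adjacent indices into decreasing order: distinct indices end
    at \<open>T 4 3 2 1\<close>, repeated ones give zero.\<close>
  have "\<forall>i j k l. T i j k l = 0"
    unfolding forall_4 d1 d2 d3 d4 d5 d6 s1[of 1 2] s1[of 1 3] s1[of 1 4] s1[of 2 3] s1[of 2 4] s1[of 3 4]
      s2[of _ 1 2] s2[of _ 1 3] s2[of _ 1 4] s2[of _ 2 3] s2[of _ 2 4] s2[of _ 3 4]
      s3[of _ _ 1 2] s3[of _ _ 1 3] s3[of _ _ 1 4] s3[of _ _ 2 3] s3[of _ _ 2 4] s3[of _ _ 3 4] b
    by simp
  then show ?thesis by (simp add: T_def)
qed

section \<open>Rank, invertibility and the explicit inverse in terms of the Pfaffian\<close>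

lemma rank_eq_card_iff_invertible:
  fixes A :: "'a::field ^ 'n ^ 'n"
  shows "rank A = CARD('n) \<longleftrightarrow> invertible A"
proof -
  have "vec.dim (rows A) = CARD('n) \<longleftrightarrow> vec.span (rows A) = UNIV"
    using vec.dim_eq_full[of "rows A"] vec.dimension_def[where ?'a='a and ?'b='n]
    by (simp only: card_cart_basis)
  also have "\<dots> \<longleftrightarrow> invertible A"
    using matrix_left_invertible_span_rows_gen[of A] by (simp add: invertible_left_inverse)
  finally show ?thesis by (simp add: row_rank_def_gen)
qed

text \<open>Dividing the Pluecker relation by a nonzero entry \<open>A $ i $ j\<close> writes every
  row as a combination of rows \<open>i\<close> and \<open>j\<close>. These two are independent
  because the diagonal vanishes.\<close>

lemma rank_skew_eq_2:
  assumes skew: "transpose A = - A" and pf: "pfaffian A = 0" and ne: "A \<noteq> 0"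
  shows "rank A = 2"
proof -
  obtain i j where ij: "A $ i $ j \<noteq> 0" using ne by (auto simp: vec_eq_iff)
  let ?u = "row i A" and ?v = "row j A"
  have nth: "row k A $ l = A $ k $ l" for k l by (simp add: row_def)
  have span: "row k A \<in> vec.span {?u, ?v}" for k
  proof -
    have "row k A = (A $ i $ k / A $ i $ j) *s ?v - (A $ j $ k / A $ i $ j) *s ?u"
    proof (simp add: vec_eq_iff nth, rule)
      fix l
      show "A $ k $ l = A $ i $ k * A $ j $ l / A $ i $ j - A $ j $ k * A $ i $ l / A $ i $ j"
        using plucker_relation[OF skew pf, of i j k l] ij by (simp add: field_simps)
    qed
    then show ?thesis
      by (metis insertCI vec.span_base vec.span_diff vec.span_scale)
  qed
  have sp: "vec.span (rows A) = vec.span {?u, ?v}"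
  proof (rule vec.span_eq[THEN iffD2], intro conjI)
    show "rows A \<subseteq> vec.span {?u, ?v}" using span by (auto simp: rows_def)
    show "{?u, ?v} \<subseteq> vec.span (rows A)" by (auto simp: rows_def intro!: vec.span_base)
  qed
  have ji: "A $ j $ i \<noteq> 0" using ij skew_entries(2)[OF skew, of i j] by simp
  have uv: "?u \<noteq> ?v" using ij skew_entries(1)[OF skew] nth by metis
  have notin: "?u \<notin> vec.span {?v}"
  proof
    assume "?u \<in> vec.span {?v}"
    then obtain c where "?u = c *s ?v" by (auto simp: vec.span_singleton)
    then have "A $ i $ j = c * A $ j $ j" using nth by (metis vector_smult_component)
    then show False using ij skew_entries(1)[OF skew] by simp
  qed
  have "?v \<noteq> 0" using ji nth by (metis zero_index)
  then have "vec.independent {?u, ?v}"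
    using notin uv by (simp add: vec.independent_insert)
  then have "vec.dim {?u, ?v} = 2"
    using uv by (subst vec.dim_eq_card_independent) auto
  then show ?thesis
    using sp by (metis row_rank_def_gen vec.dim_span)
qed

lemma invertible_skew_iff_pfaffian:
  assumes "transpose A = - A"
  shows "invertible A \<longleftrightarrow> pfaffian A \<noteq> 0"
proof
  assume inv: "invertible A"
  then obtain B where B: "B ** A = mat 1" by (auto simp: invertible_def)
  show "pfaffian A \<noteq> 0"
  proof
    assume pf: "pfaffian A = 0"
    have "A \<noteq> 0"
    proof
      assume "A = 0"
      then have "(mat 1 :: complex^4^4) = 0" using B by simp
      then have "(mat 1 :: complex^4^4) $ 1 $ 1 = 0" by simp
      then show False by (simp add: mat_def)
    qed
    then have "rank A = 2" using rank_skew_eq_2 assms pf by blast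
    then show False using rank_eq_card_iff_invertible[of A] inv by simp
  qed
next
  assume pf: "pfaffian A \<noteq> 0"
  let ?B = "inverse (pfaffian A) *\<^sub>m pf_dual A"
  have "A ** ?B = mat 1"
  proof -
    have "(A ** ?B) $ i $ j = inverse (pfaffian A) * (A ** pf_dual A) $ i $ j" for i j
      by (simp add: matrix_matrix_mult_def cscale_def sum_4 algebra_simps)
    then show ?thesis using pf by (simp add: vec_eq_iff pf_dual_mult[OF assms] mat_def)
  qed
  then show "invertible A" by (metis invertible_right_inverse)
qed

lemma matrix_inv_skew_mult:
  assumes "transpose b = - b" "pfaffian b \<noteq> 0"
  shows "matrix_inv b ** b = mat 1" "b ** matrix_inv b = mat 1"
proof -
  obtain c where "b ** c = mat 1 \<and> c ** b = mat 1"
    using invertible_skew_iff_pfaffian[OF assms(1)] assms(2) by (auto simp: invertible_def)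
  then have "b ** matrix_inv b = mat 1 \<and> matrix_inv b ** b = mat 1"
    unfolding matrix_inv_def by (rule someI)
  then show "matrix_inv b ** b = mat 1" "b ** matrix_inv b = mat 1" by auto
qed

lemma matrix_inv_skew:
  assumes "transpose A = - A" "pfaffian A \<noteq> 0"
  shows "matrix_inv A = inverse (pfaffian A) *\<^sub>m pf_dual A"
proof -
  let ?B = "inverse (pfaffian A) *\<^sub>m pf_dual A"
  have "(A ** ?B) $ i $ j = inverse (pfaffian A) * (A ** pf_dual A) $ i $ j" for i j
    by (simp add: matrix_matrix_mult_def cscale_def sum_4 algebra_simps)
  then have 1: "A ** ?B = mat 1" using assms(2) by (simp add: vec_eq_iff pf_dual_mult[OF assms(1)] mat_def)
  then have "matrix_inv A ** A ** ?B = matrix_inv A" by (simp flip: matrix_mul_assoc)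
  then show ?thesis using matrix_inv_skew_mult(1)[OF assms] by simp
qed

subsection \<open>Partial derivatives\<close>

abbreviation coord :: "point \<Rightarrow> 4 \<Rightarrow> complex" where
  "coord x i \<equiv> complex_of_real (x $ i)"

text \<open>Frechet differentiability with the gradient as explicit data. It yields both
  \<open>differentiable\<close> and every \<open>pd\<close>, and it is closed under algebraic
  operations, so derivatives can be found by applying rules.\<close>

definition has_pds :: "scalar_field \<Rightarrow> (4 \<Rightarrow> complex) \<Rightarrow> point \<Rightarrow> bool" where
  "has_pds F g x \<longleftrightarrow> (F has_derivative (\<lambda>h. \<Sum>j\<in>UNIV. coord h j * g j)) (at x)"

lemma has_pds_imp_differentiable: "has_pds F g x \<Longrightarrow> F differentiable (at x)"
  unfolding has_pds_def by (rule differentiableI)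

lemma has_pds_imp_pd:
  assumes "has_pds F g x"
  shows "pd j F x = g j"
proof -
  have line: "((\<lambda>t. x + t *\<^sub>R axis j 1) has_derivative (\<lambda>t. t *\<^sub>R axis j 1)) (at (0::real))"
    by (auto intro!: derivative_eq_intros)
  have "((\<lambda>t. F (x + t *\<^sub>R axis j 1)) has_derivative
      (\<lambda>t. \<Sum>k\<in>UNIV. complex_of_real ((t *\<^sub>R axis j 1 :: real ^ 4) $ k) * g k)) (at 0)"
    by (rule has_derivative_compose[OF line]) (use assms in \<open>simp add: has_pds_def\<close>)
  also have "(\<lambda>t. \<Sum>k\<in>UNIV. complex_of_real ((t *\<^sub>R axis j 1 :: real ^ 4) $ k) * g k) = (\<lambda>t. t *\<^sub>R g j)"
  proof
    fix t :: real
    have "(\<Sum>k\<in>UNIV. complex_of_real ((t *\<^sub>R axis j 1 :: real ^ 4) $ k) * g k)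
        = (\<Sum>k\<in>UNIV. if k = j then t *\<^sub>R g j else 0)"
      by (rule sum.cong) (auto simp: axis_def scaleR_conv_of_real[where ?'a=complex])
    then show "(\<Sum>k\<in>UNIV. complex_of_real ((t *\<^sub>R axis j 1 :: real ^ 4) $ k) * g k) = t *\<^sub>R g j"
      by simp
  qed
  finally have "((\<lambda>t. F (x + t *\<^sub>R axis j 1)) has_vector_derivative g j) (at 0)"
    by (simp add: has_vector_derivative_def)
  then show ?thesis
    unfolding pd_def by (rule vector_derivative_at)
qed

lemma has_pds_transform_open:
  assumes "has_pds F g x" "open S" "x \<in> S" "\<And>y. y \<in> S \<Longrightarrow> F y = G y"
  shows "has_pds G g x"
  using has_derivative_transform_within_open[OF assms(1)[unfolded has_pds_def] assms(2,3,4)]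
  unfolding has_pds_def by simp

lemma has_pds_eq_rhs:
  assumes "has_pds F g x" "\<And>j. g j = h j"
  shows "has_pds F h x"
proof -
  have "g = h" using assms(2) by (rule ext)
  then show ?thesis using assms(1) by simp
qed

lemma has_pds_const: "has_pds (\<lambda>y. c) (\<lambda>j. 0) x"
  unfolding has_pds_def by simp

lemma has_pds_coord: "has_pds (\<lambda>y. coord y i) (\<lambda>j. if j = i then 1 else 0) x"
proof -
  have d: "((\<lambda>y::point. coord y i) has_derivative (\<lambda>h. coord h i)) (at x)"
    by (intro bounded_linear.has_derivative[OF bounded_linear_of_real] bounded_linear_imp_has_derivative
        bounded_linear_vec_nth)
  have eq: "(\<lambda>h::point. coord h i) = (\<lambda>h. \<Sum>j\<in>UNIV. coord h j * (if j = i then 1 else 0))"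
    by (simp add: if_distrib cong: if_cong)
  show ?thesis unfolding has_pds_def by (rule has_derivative_eq_rhs[OF d eq])
qed

lemma has_pds_add:
  "has_pds F f x \<Longrightarrow> has_pds G g x \<Longrightarrow> has_pds (\<lambda>y. F y + G y) (\<lambda>j. f j + g j) x"
  unfolding has_pds_def
  by (drule (1) has_derivative_add) (simp add: algebra_simps sum.distrib)

lemma has_pds_minus: "has_pds F f x \<Longrightarrow> has_pds (\<lambda>y. - F y) (\<lambda>j. - f j) x"
  unfolding has_pds_def
  by (drule has_derivative_minus) (simp add: sum_negf)

lemma has_pds_diff:
  "has_pds F f x \<Longrightarrow> has_pds G g x \<Longrightarrow> has_pds (\<lambda>y. F y - G y) (\<lambda>j. f j - g j) x"
  unfolding has_pds_def
  by (drule (1) has_derivative_diff) (simp add: algebra_simps sum_subtractf)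

lemma has_pds_mult:
  "has_pds F f x \<Longrightarrow> has_pds G g x \<Longrightarrow> has_pds (\<lambda>y. F y * G y) (\<lambda>j. F x * g j + f j * G x) x"
  unfolding has_pds_def
  by (drule (1) has_derivative_mult)
     (simp add: algebra_simps sum.distrib sum_distrib_left sum_distrib_right)

lemma has_pds_power2:
  "has_pds F f x \<Longrightarrow> has_pds (\<lambda>y. (F y)\<^sup>2) (\<lambda>j. 2 * F x * f j) x"
  unfolding power2_eq_square by (rule has_pds_eq_rhs[OF has_pds_mult]) (assumption, assumption, algebra)

lemma has_pds_inverse:
  assumes "has_pds F f x" "F x \<noteq> 0"
  shows "has_pds (\<lambda>y. inverse (F y)) (\<lambda>j. - f j / (F x)\<^sup>2) x"
proof -
  have "((\<lambda>y. inverse (F y)) has_derivative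
      (\<lambda>h. - (inverse (F x) * (\<Sum>j\<in>UNIV. coord h j * f j) * inverse (F x)))) (at x)"
    using assms(1) unfolding has_pds_def by (rule Deriv.has_derivative_inverse[where f = F, OF assms(2)])
  also have "(\<lambda>h::point. - (inverse (F x) * (\<Sum>j\<in>UNIV. coord h j * f j) * inverse (F x)))
     = (\<lambda>h. \<Sum>j\<in>UNIV. coord h j * (- f j / (F x)\<^sup>2))"
    by (simp add: fun_eq_iff sum_4 divide_inverse power2_eq_square algebra_simps)
  finally show ?thesis unfolding has_pds_def .
qed

lemmas has_pds_intros = has_pds_const has_pds_coord has_pds_add has_pds_minus has_pds_diff has_pds_mult
    has_pds_power2

lemma pd_cong_open:
  assumes "open S" "x \<in> S" "\<And>y. y \<in> S \<Longrightarrow> F y = G y"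
  shows "pd j F x = pd j G x"
proof -
  have "open ((\<lambda>t::real. x + t *\<^sub>R axis j 1) -` S)"
    by (intro open_vimage assms(1) continuous_intros)
  then have "\<forall>\<^sub>F t in nhds 0. t \<in> (\<lambda>t::real. x + t *\<^sub>R axis j 1) -` S"
    by (rule eventually_nhds_in_open) (simp add: assms(2))
  then have "\<forall>\<^sub>F t in nhds 0. F (x + t *\<^sub>R axis j 1) = G (x + t *\<^sub>R axis j 1)"
    by (rule eventually_mono) (simp add: assms(3))
  then show ?thesis
    unfolding pd_def by (intro vector_derivative_cong_eq) simp_all
qed

section \<open>The phase space and inverse powers of the radius\<close>

lemma open_phase_space: "open phase_space"
proof -
  have "phase_space = {x::point. x $ 1 \<noteq> 0} \<union> {x. x $ 2 \<noteq> 0}"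
    by (auto simp: phase_space_def)
  moreover have "open {x::point. x $ i \<noteq> 0}" for i
    by (intro open_Collect_neq continuous_intros)
  ultimately show ?thesis using open_Un by metis
qed

text \<open>With kappa in the numerator these functions are closed under differentiation up to
  coordinate factors: each derivative raises \<open>n\<close> by two. Square roots therefore never
  have to be expanded.\<close>

definition radial :: "real \<Rightarrow> nat \<Rightarrow> scalar_field" where
  "radial \<kappa> n x = complex_of_real (\<kappa> / sqrt ((x $ 1)\<^sup>2 + (x $ 2)\<^sup>2) ^ n)"

lemma phase_space_radius: "x \<in> phase_space \<Longrightarrow> (x $ 1)\<^sup>2 + (x $ 2)\<^sup>2 > 0"
  by (auto simp: phase_space_def sum_power2_gt_zero_iff)

lemma has_pds_radial:
  assumes "x \<in> phase_space"
  shows "has_pds (radial \<kappa> n)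
    (\<lambda>j. - of_nat n * radial \<kappa> (n + 2) x * (if j = 1 then coord x 1 else if j = 2 then coord x 2 else 0)) x"
proof -
  define \<rho> where "\<rho> = (\<lambda>y::point. (y $ 1)\<^sup>2 + (y $ 2)\<^sup>2)"
  have pos: "\<rho> x > 0" using phase_space_radius[OF assms] by (simp add: \<rho>_def)
  have d\<rho>: "(\<rho> has_derivative (\<lambda>h. 2 * (x $ 1 * h $ 1 + x $ 2 * h $ 2))) (at x)"
    unfolding \<rho>_def
    by (auto intro!: derivative_eq_intros bounded_linear.has_derivative[OF bounded_linear_vec_nth] simp:
        algebra_simps)
  have "((\<lambda>u. \<kappa> / sqrt u ^ n) has_real_derivative - (real n * \<kappa> / (2 * sqrt (\<rho> x) ^ (n + 2)))) (at (\<rho> x))"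
  proof (cases n)
    case 0 then show ?thesis by simp
  next
    case (Suc m)
    have "((\<lambda>u. sqrt u ^ Suc m) has_real_derivative
        (1 + real m) * (inverse (sqrt (\<rho> x)) / 2 * sqrt (\<rho> x) ^ m)) (at (\<rho> x))"
      by (rule DERIV_power_Suc[OF DERIV_real_sqrt[OF pos]])
    from DERIV_divide[OF DERIV_const this, of \<kappa>] show ?thesis
      unfolding Suc by (rule DERIV_cong) (use pos in \<open>auto simp: field_simps\<close>)
  qed
  then have "((\<lambda>u. \<kappa> / sqrt u ^ n) has_derivative (\<lambda>h. - (real n * \<kappa> / (2 * sqrt (\<rho> x) ^ (n
      + 2))) * h)) (at (\<rho> x))"
    unfolding has_field_derivative_def .
  from has_derivative_compose[OF d\<rho> this]
  have "((\<lambda>y. \<kappa> / sqrt (\<rho> y) ^ n) has_derivative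
     (\<lambda>h. - (real n * \<kappa> / sqrt (\<rho> x) ^ (n + 2)) * (x $ 1 * h $ 1 + x $ 2 * h $ 2))) (at x)"
    by (simp add: algebra_simps)
  then have "((\<lambda>y. complex_of_real (\<kappa> / sqrt (\<rho> y) ^ n)) has_derivative
     (\<lambda>h. complex_of_real (- (real n * \<kappa> / sqrt (\<rho> x) ^ (n + 2)) * (x $ 1 * h $ 1
         + x $ 2 * h $ 2)))) (at x)"
    by (rule bounded_linear.has_derivative[OF bounded_linear_of_real])
  then show ?thesis
    unfolding has_pds_def radial_def \<rho>_def
        by (rule has_derivative_eq_rhs) (simp add: fun_eq_iff sum_4 algebra_simps add_divide_distrib)
qed

lemma radial_relations:
  assumes "x \<in> phase_space"
  shows "radial \<kappa> 3 x = radial \<kappa> 5 x * ((coord x 1)\<^sup>2 + (coord x 2)\<^sup>2)"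
    and "radial \<kappa> 1 x = radial \<kappa> 5 x * ((coord x 1)\<^sup>2 + (coord x 2)\<^sup>2)\<^sup>2"
proof -
  define s where "s = sqrt ((x $ 1)\<^sup>2 + (x $ 2)\<^sup>2)"
  have s: "s > 0" "s\<^sup>2 = (x $ 1)\<^sup>2 + (x $ 2)\<^sup>2"
    using phase_space_radius[OF assms] by (simp_all add: s_def)
  have "\<kappa> / s ^ 3 = \<kappa> / s ^ 5 * s\<^sup>2" "\<kappa> / s ^ 1 = \<kappa> / s ^ 5 * (s\<^sup>2)\<^sup>2"
    using s(1) by (simp_all add: field_simps eval_nat_numeral)
  then show "radial \<kappa> 3 x = radial \<kappa> 5 x * ((coord x 1)\<^sup>2 + (coord x 2)\<^sup>2)"
    and "radial \<kappa> 1 x = radial \<kappa> 5 x * ((coord x 1)\<^sup>2 + (coord x 2)\<^sup>2)\<^sup>2"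
    unfolding radial_def s_def[symmetric] s(2)
    by (simp_all flip: of_real_mult of_real_add of_real_power)
qed

subsection \<open>The nine-parameter family and its first derivatives\<close>

text \<open>Keeps the exponent in \<open>radial \<kappa> 1\<close> from being rewritten to \<open>Suc 0\<close>.\<close>

declare One_nat_def [simp del]

lemma vector_4_nth:
  fixes a b c d :: "'a::zero"
  shows "(vector [a, b, c, d] :: 'a ^ 4) $ 1 = a" "(vector [a, b, c, d] :: 'a ^ 4) $ 2 = b"
    "(vector [a, b, c, d] :: 'a ^ 4) $ 3 = c" "(vector [a, b, c, d] :: 'a ^ 4) $ 4 = d"
  unfolding vector_def by simp_all

lemma has_pds_vector4:
  assumes "has_pds F g x" "g 1 = a" "g 2 = b" "g 3 = c" "g 4 = d"
  shows "has_pds F (\<lambda>j. (vector [a, b, c, d] :: complex ^ 4) $ j) x"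
proof (rule has_pds_eq_rhs[OF assms(1)])
  fix j show "g j = (vector [a, b, c, d] :: complex ^ 4) $ j"
    using exhaust_4[of j] assms(2-) by (auto simp: vector_4_nth)
qed

lemma radial_1: "x \<in> phase_space \<Longrightarrow>
    radial \<kappa> 1 x = radial \<kappa> 3 x * ((coord x 1)\<^sup>2 + (coord x 2)\<^sup>2)"
  by (simp add: radial_relations power2_eq_square algebra_simps)

lemma kepler_H_eq:
  "kepler_H \<kappa> = (\<lambda>x. ((coord x 3)\<^sup>2 + (coord x 4)\<^sup>2) * (1/2) - radial \<kappa> 1 x)"
  by (simp add: fun_eq_iff kepler_H_def radial_def)

lemma kepler_K3_eq: "kepler_K3 = (\<lambda>x. coord x 1 * coord x 4 - coord x 2 * coord x 3)"
  by (simp add: fun_eq_iff kepler_K3_def)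

lemma kepler_K1_eq:
  "kepler_K1 \<kappa> = (\<lambda>x. - (coord x 3 * kepler_K3 x) - coord x 2 * radial \<kappa> 1 x)"
  by (simp add: fun_eq_iff kepler_K1_def kepler_K3_def radial_def Let_def algebra_simps)

lemma kepler_K2_eq:
  "kepler_K2 \<kappa> = (\<lambda>x. - (coord x 4 * kepler_K3 x) + coord x 1 * radial \<kappa> 1 x)"
  by (simp add: fun_eq_iff kepler_K2_def kepler_K3_def radial_def Let_def algebra_simps)

lemma has_pds_kepler_K3:
  "has_pds kepler_K3 (\<lambda>j. (vector [coord x 4, - coord x 3, - coord x 2, coord x 1] :: complex ^ 4) $ j) x"
  unfolding kepler_K3_eq
  by (rule has_pds_vector4, (rule has_pds_intros)+) simp_all

lemma has_pds_kepler_H: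
  assumes "x \<in> phase_space"
  shows "has_pds (kepler_H \<kappa>) (\<lambda>j. (vector [coord x 1 * radial \<kappa> 3 x,
    coord x 2 * radial \<kappa> 3 x, coord x 3, coord x 4] :: complex ^ 4) $ j) x"
  unfolding kepler_H_eq
  by (rule has_pds_vector4, (rule has_pds_intros has_pds_radial[OF assms])+) simp_all

lemma has_pds_kepler_K1:
  fixes \<kappa> :: real
  assumes "x \<in> phase_space"
  defines "q1 \<equiv> coord x 1" and "q2 \<equiv> coord x 2"
    and "p1 \<equiv> coord x 3" and "p2 \<equiv> coord x 4" and "w \<equiv> radial \<kappa> 3 x"
  shows "has_pds (kepler_K1 \<kappa>) (\<lambda>j. (vector [- p1 * p2 + q1 * q2 * w, p1\<^sup>2 - q1\<^sup>2 * w,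
    2 * p1 * q2 - p2 * q1, - p1 * q1] :: complex ^ 4) $ j) x"
  unfolding kepler_K1_eq
  apply (rule has_pds_vector4, (rule has_pds_intros has_pds_radial[OF assms(1)] has_pds_kepler_K3)+)
  by (simp_all add: vector_4_nth kepler_K3_eq radial_1[OF assms(1), simplified] q1_def q2_def p1_def p2_def
      w_def algebra_simps power2_eq_square)

lemma has_pds_kepler_K2:
  fixes \<kappa> :: real
  assumes "x \<in> phase_space"
  defines "q1 \<equiv> coord x 1" and "q2 \<equiv> coord x 2"
    and "p1 \<equiv> coord x 3" and "p2 \<equiv> coord x 4" and "w \<equiv> radial \<kappa> 3 x"
  shows "has_pds (kepler_K2 \<kappa>) (\<lambda>j. (vector [- p2\<^sup>2 + q2\<^sup>2 * w, p1 * p2 - q1 * q2 * w,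
    p2 * q2, p1 * q2 - 2 * p2 * q1] :: complex ^ 4) $ j) x"
  unfolding kepler_K2_eq
  apply (rule has_pds_vector4, (rule has_pds_intros has_pds_radial[OF assms(1)] has_pds_kepler_K3)+)
  by (simp_all add: vector_4_nth kepler_K3_eq radial_1[OF assms(1), simplified] q1_def q2_def p1_def p2_def
      w_def algebra_simps power2_eq_square)

lemma canonical_apply:
  assumes "has_pds F (\<lambda>j. (vector [a, b, c, d] :: complex ^ 4) $ j) x"
  shows "bivector_apply canonical_P F x = vector [c, d, - a, - b]"
  by (simp add: bivector_apply_def canonical_P_def differential_def has_pds_imp_pd[OF assms]
      vec_eq_iff forall_4 matrix_vector_mult_def sum_4 skew_matrix_nth vector_4_nth)

text \<open>
  Here \<open>u\<close>, \<open>w\<close> and \<open>v\<close> stand for \<open>\<kappa> / r\<close>, \<open>\<kappa> / r ^ 3\<close> and \<open>\<kappa> / r ^ 5\<close>, and \<open>dq1, \<dots>, dw\<close> for the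
  components of a tangent vector.
\<close>

definition fam_scalar :: "(nat \<Rightarrow> complex) \<Rightarrow> complex \<Rightarrow> complex \<Rightarrow> complex \<Rightarrow> complex \<Rightarrow> complex \<Rightarrow> complex" where
  "fam_scalar a q1 q2 p1 p2 u = (let L = q1 * p2 - q2 * p1 in
     a 3 * ((p1\<^sup>2 + p2\<^sup>2) / 2 - u) + a 4 * L\<^sup>2 + a 5 * (- p1 * L - q2 * u) + a 6 * (- p2 * L + q1 * u)
         + a 7 * L + a 8)"

definition fam_matrix :: "(nat \<Rightarrow> complex) \<Rightarrow> complex \<Rightarrow> complex \<Rightarrow> complex \<Rightarrow> complex \<Rightarrow> complex \<Rightarrow> complex \<Rightarrow>
    complex ^ 4 ^ 4" where
  "fam_matrix a q1 q2 p1 p2 u w = (let L = q1 * p2 - q2 * p1; f = fam_scalar a q1 q2 p1 p2 u in skew_matrix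
     ((a 1 * q1 + a 2 * q2 + a 9) * L)
     (a 1 * (- p2 * L + q1 * q2\<^sup>2 * w) + a 2 * q2 ^ 3 * w + f + a 9 * (- p2\<^sup>2 / 2 + q2\<^sup>2 * w))
     (a 1 * (p1 * L - q1\<^sup>2 * q2 * w) - a 2 * q1 * q2\<^sup>2 * w + a 9 * (p1 * p2 / 2 - q1 * q2 * w))
     (- a 1 * q1\<^sup>2 * q2 * w + a 2 * (- p2 * L - q1 * q2\<^sup>2 * w) + a 9 * (p1 * p2 / 2 - q1 * q2 * w))
     (a 1 * q1 ^ 3 * w + a 2 * (p1 * L + q1\<^sup>2 * q2 * w) + f + a 9 * (- p1\<^sup>2 / 2 + q1\<^sup>2 * w))
     (- (a 1 * q1 + a 2 * q2 + a 9 / 2) * w * L))"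

definition fam_dscalar where
  "fam_dscalar (a :: nat \<Rightarrow> complex) q1 q2 p1 p2 u dq1 dq2 dp1 dp2 du =
    (let L = q1 * p2 - q2 * p1; dL = dq1 * p2 + q1 * dp2 - dq2 * p1 - q2 * dp1 in
     a 3 * (p1 * dp1 + p2 * dp2 - du) + 2 * a 4 * L * dL + a 5 * (- dp1 * L - p1 * dL - dq2 * u - q2 * du)
     + a 6 * (- dp2 * L - p2 * dL + dq1 * u + q1 * du) + a 7 * dL)"

text \<open>The formal total differential of \<open>fam_matrix\<close>, with \<open>u\<close> and
  \<open>w\<close> as independent coordinates. Polynomial differentiation is thus kept apart from
  the chain rule for the radius.\<close>

definition fam_dmatrix where
  "fam_dmatrix (a :: nat \<Rightarrow> complex) q1 q2 p1 p2 u w dq1 dq2 dp1 dp2 du dw =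
    (let L = q1 * p2 - q2 * p1; dL = dq1 * p2 + q1 * dp2 - dq2 * p1 - q2 * dp1;
       df = fam_dscalar a q1 q2 p1 p2 u dq1 dq2 dp1 dp2 du in skew_matrix
     ((a 1 * dq1 + a 2 * dq2) * L + (a 1 * q1 + a 2 * q2 + a 9) * dL)
     (a 1 * (- dp2 * L - p2 * dL + dq1 * q2\<^sup>2 * w + 2 * q1 * q2 * dq2 * w + q1 * q2\<^sup>2 * dw)
       + a 2 * (3 * q2\<^sup>2 * dq2 * w + q2 ^ 3 * dw) + df + a 9 * (- p2 * dp2 + 2 * q2 * dq2 * w + q2\<^sup>2 * dw))
     (a 1 * (dp1 * L + p1 * dL - 2 * q1 * dq1 * q2 * w - q1\<^sup>2 * dq2 * w - q1\<^sup>2 * q2 * dw)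
       - a 2 * (dq1 * q2\<^sup>2 * w + 2 * q1 * q2 * dq2 * w + q1 * q2\<^sup>2 * dw)
       + a 9 * ((dp1 * p2 + p1 * dp2) / 2 - dq1 * q2 * w - q1 * dq2 * w - q1 * q2 * dw))
     (- a 1 * (2 * q1 * dq1 * q2 * w + q1\<^sup>2 * dq2 * w + q1\<^sup>2 * q2 * dw)
       + a 2 * (- dp2 * L - p2 * dL - dq1 * q2\<^sup>2 * w - 2 * q1 * q2 * dq2 * w - q1 * q2\<^sup>2 * dw)
       + a 9 * ((dp1 * p2 + p1 * dp2) / 2 - dq1 * q2 * w - q1 * dq2 * w - q1 * q2 * dw))
     (a 1 * (3 * q1\<^sup>2 * dq1 * w + q1 ^ 3 * dw)
       + a 2 * (dp1 * L + p1 * dL + 2 * q1 * dq1 * q2 * w + q1\<^sup>2 * dq2 * w + q1\<^sup>2 * q2 * dw)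
       + df + a 9 * (- p1 * dp1 + 2 * q1 * dq1 * w + q1\<^sup>2 * dw))
     (- (a 1 * dq1 + a 2 * dq2) * w * L - (a 1 * q1 + a 2 * q2 + a 9 / 2) * (dw * L + w * dL)))"

text \<open>Here the chain rule enters: \<open>r2\<close> is the squared radius and
  \<open>dr\<close> is q . dq, half of its differential. Then d(kappa/r) = - v r2 dr and
  d(kappa/r^3) = - 3 v dr. The variable \<open>v\<close> stays free, so later identities hold for
  every complex \<open>v\<close>.\<close>

definition fam_pd :: "(nat \<Rightarrow> complex) \<Rightarrow> complex \<Rightarrow> complex \<Rightarrow> complex \<Rightarrow> complex \<Rightarrow> complex \<Rightarrow> 4 \<Rightarrow> complex ^ 4 ^
    4" where
  "fam_pd a q1 q2 p1 p2 v m = (let r2 = q1\<^sup>2 + q2\<^sup>2; dq1 = (if m = 1 then 1 else 0); dq2 = (if m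
      = 2 then 1 else 0);
       dp1 = (if m = 3 then 1 else 0); dp2 = (if m = 4 then 1 else 0); dr = q1 * dq1 + q2 * dq2 in
     fam_dmatrix a q1 q2 p1 p2 (v * r2\<^sup>2) (v * r2) dq1 dq2 dp1 dp2 (- v * r2 * dr) (- 3 * v * dr))"

lemma kepler_family_eq:
  assumes "x \<in> phase_space"
  shows "kepler_family \<kappa> a x = fam_matrix a (coord x 1) (coord x 2)
    (coord x 3) (coord x 4) (radial \<kappa> 1 x) (radial \<kappa> 3 x)"
proof -
  have Pt: "kepler_Pt \<kappa> x = (let q1 = coord x 1; q2 = coord x 2; p1 = coord x 3;
      p2 = coord x 4; w = radial \<kappa> 3 x in skew_matrix (q1 * p2 - p1 * q2) (- (p2\<^sup>2 / 2) + w * q2\<^sup>2)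
        (p1 * p2 / 2 - w * q1 * q2) (p1 * p2 / 2 - w * q1 * q2) (- (p1\<^sup>2 / 2)
            + w * q1\<^sup>2) (w * (p1 * q2 - p2 * q1) / 2))"
  proof -
    have "((x $ 1)\<^sup>2 + (x $ 2)\<^sup>2) powr (3 / 2) = sqrt ((x $ 1)\<^sup>2 + (x $ 2)\<^sup>2) ^ 3"
      using phase_space_radius[OF assms] powr_powr[of "(x $ 1)\<^sup>2 + (x $ 2)\<^sup>2" "1 / 2" 3]
      by (simp add: powr_half_sqrt)
    then show ?thesis
      unfolding kepler_Pt_def radial_def Let_def by (simp add: mult.commute[of _ 2])
  qed
  show ?thesis
    unfolding kepler_family_def Pt
    unfolding kepler_X1_def kepler_X2_def kepler_X3_def canonical_apply[OF has_pds_kepler_K3]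
      canonical_apply[OF has_pds_kepler_K1[OF assms]] canonical_apply[OF has_pds_kepler_K2[OF assms]]
    unfolding kepler_H_eq kepler_K1_eq kepler_K2_eq kepler_K3_eq canonical_P_def fam_matrix_def
        fam_scalar_def Let_def
    unfolding vec_eq_iff forall_4
    by (simp add: wedge_def cscale_def skew_matrix_nth vector_4_nth algebra_simps power2_eq_square
        power3_eq_cube add_divide_distrib diff_divide_distrib)
qed

lemma has_pds_kepler_family:
  assumes x: "x \<in> phase_space"
  shows "has_pds (\<lambda>y. kepler_family \<kappa> a y $ i $ j)
    (\<lambda>m. fam_pd a (coord x 1) (coord x 2)
    (coord x 3) (coord x 4) (radial \<kappa> 5 x) m $ i $ j) x"
proof -
  have "\<forall>i j. has_pds (\<lambda>y. fam_matrix a (coord y 1) (coord y 2)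
    (coord y 3) (coord y 4) (radial \<kappa> 1 y) (radial \<kappa> 3 y) $ i $ j)
    (\<lambda>m. fam_pd a (coord x 1) (coord x 2)
    (coord x 3) (coord x 4) (radial \<kappa> 5 x) m $ i $ j) x"
    unfolding forall_4 fam_matrix_def fam_pd_def fam_dmatrix_def fam_scalar_def fam_dscalar_def Let_def
        skew_matrix_nth
      power2_eq_square power3_eq_cube divide_inverse
    apply (intro conjI; rule has_pds_eq_rhs, (rule has_pds_intros has_pds_radial[OF x])+)
    by (simp_all add: radial_relations[OF x, simplified] algebra_simps power2_eq_square add_divide_distrib
        diff_divide_distrib)
  then have "has_pds (\<lambda>y. fam_matrix a (coord y 1) (coord y 2)
    (coord y 3) (coord y 4) (radial \<kappa> 1 y) (radial \<kappa> 3 y) $ i $ j)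
    (\<lambda>m. fam_pd a (coord x 1) (coord x 2)
    (coord x 3) (coord x 4) (radial \<kappa> 5 x) m $ i $ j) x" by blast
  then show ?thesis
    \<comment> \<open>The coordinate formula is available only on the phase space, whose openness
      carries it over to derivatives.\<close>
    by (rule has_pds_transform_open[OF _ open_phase_space x]) (simp add: kepler_family_eq)
qed

subsection \<open>The Jacobi identity: sufficient conditions\<close>

text \<open>Cyclic symmetry and one transposition generate full antisymmetry, which leaves four
  index triples. This serves both the Jacobi identity and the closedness of the inverse
  forms.\<close>

lemma alternating_eq_0:
  fixes T :: "4 \<Rightarrow> 4 \<Rightarrow> 4 \<Rightarrow> complex"
  assumes cyc: "\<And>i j k. T j k i = T i j k" and sw: "\<And>i j k. T j i k = - T i j k"
    and T: "T 1 2 3 = 0" "T 1 2 4 = 0" "T 1 3 4 = 0" "T 2 3 4 = 0"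
  shows "T i j k = 0"
proof -
  have d: "T i i k = 0" for i k
  proof -
    have "2 * T i i k = 0" using sw[of i i k] by algebra
    then show ?thesis by simp
  qed
  have all: "T i j k = 0 \<Longrightarrow> T j k i = 0 \<and> T k i j = 0 \<and> T j i k = 0 \<and> T i k j = 0 \<and> T k j i = 0" for i j k
    using cyc sw by (metis neg_equal_0_iff_equal)
  have d': "T i k k = 0" "T k i k = 0" for i k using d cyc by metis+
  have "\<forall>i j k. T i j k = 0"
    unfolding forall_4 using all[OF T(1)] all[OF T(2)] all[OF T(3)] all[OF T(4)] T by (simp add: d d')
  then show ?thesis by blast
qed

text \<open>Half of the Schouten bracket up to sign, with \<open>b\<close> and \<open>D\<close> as
  unrelated arguments. With \<open>b\<close> the value of one bivector and \<open>D\<close> the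
  derivatives of another it also expresses the bracket with a constant bivector.\<close>

definition jacobiator :: "complex ^ 4 ^ 4 \<Rightarrow> (4 \<Rightarrow> complex ^ 4 ^ 4) \<Rightarrow> 4 \<Rightarrow> 4 \<Rightarrow> 4 \<Rightarrow> complex" where
  "jacobiator b D i j k = (\<Sum>m\<in>UNIV. b $ m $ k * D m $ i $ j + b $ m $ i * D m $ j $ k
      + b $ m $ j * D m $ k $ i)"

lemma jacobiator_eq_0:
  assumes skew: "\<And>m. transpose (D m) = - D m"
    and J: "jacobiator b D 1 2 3 = 0" "jacobiator b D 1 2 4 = 0" "jacobiator b D 1 3 4
        = 0" "jacobiator b D 2 3 4 = 0"
  shows "jacobiator b D i j k = 0"
proof (rule alternating_eq_0[of "jacobiator b D", OF _ _ J])
  let ?J = "jacobiator b D"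
  have s: "D m $ j $ i = - D m $ i $ j" for m i j using skew_entries(2)[OF skew] .
  show "?J j k i = ?J i j k" for i j k by (simp add: jacobiator_def algebra_simps)
  show "?J j i k = - ?J i j k" for i j k
    unfolding jacobiator_def sum_negf[symmetric]
    by (rule sum.cong) (simp_all add: s[of _ i j] s[of _ j k] s[of _ k i] algebra_simps)
qed

lemma transpose_fam_matrix: "transpose (fam_matrix a q1 q2 p1 p2 u w) = - fam_matrix a q1 q2 p1 p2 u w"
  by (simp add: fam_matrix_def Let_def transpose_skew_matrix)

lemma transpose_fam_pd: "transpose (fam_pd a q1 q2 p1 p2 v m) = - fam_pd a q1 q2 p1 p2 v m"
  by (simp add: fam_pd_def fam_dmatrix_def Let_def transpose_skew_matrix)

lemma schouten_self:
  assumes "\<And>i j. has_pds (\<lambda>y. B y $ i $ j) (\<lambda>m. D m $ i $ j) x"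
  shows "schouten B B i j k x = - 2 * jacobiator (B x) D i j k"
  unfolding schouten_def jacobiator_def has_pds_imp_pd[OF assms]
  by (simp add: sum_4 algebra_simps)


text \<open>\<open>canonical_P\<close> is constant, so only the terms differentiating
  \<open>B\<close> survive.\<close>

lemma schouten_canonical:
  assumes "\<And>i j. has_pds (\<lambda>y. B y $ i $ j) (\<lambda>m. D m $ i $ j) x"
  shows "schouten canonical_P B i j k x = - jacobiator (canonical_P x) D i j k"
proof -
  have "pd m (\<lambda>y. canonical_P y $ i $ j) x = 0" for m i j
    by (rule has_pds_imp_pd[of _ "\<lambda>m. 0"]) (simp add: canonical_P_def has_pds_const)
  then show ?thesis
    unfolding schouten_def jacobiator_def has_pds_imp_pd[OF assms] by (simp add: sum_4 algebra_simps)
qed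

lemmas fam_expand = sum_4 fam_matrix_def fam_pd_def fam_dmatrix_def fam_scalar_def fam_dscalar_def Let_def
    skew_matrix_nth

lemmas poly_expand = algebra_simps power2_eq_square power3_eq_cube add_divide_distrib diff_divide_distrib

abbreviation fam_jacobiator where
  "fam_jacobiator a q1 q2 p1 p2 v \<equiv> jacobiator
     (fam_matrix a q1 q2 p1 p2 (v * (q1\<^sup>2 + q2\<^sup>2)\<^sup>2) (v * (q1\<^sup>2 + q2\<^sup>2))) (fam_pd a q1 q2 p1 p2 v)"

text \<open>For (a1 X1 + a2 X2) wedge X3 plus a8 P, the four components together form, up to sign,
  (a1^2 + a2^2) K3^2 times the wedge of P with the Kepler field. Vanishing is thus one quadratic
  condition on the parameters.\<close>

lemma fam_jacobiator_decomposable_123: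
  assumes "a 3 = 0" "a 4 = 0" "a 5 = 0" "a 6 = 0" "a 7 = 0" "a 9 = 0"
  shows "fam_jacobiator a q1 q2 p1 p2 v 1 2 3 = - p2 * (q1 * p2 - q2 * p1)\<^sup>2 * (a 1 * a 1 + a 2 * a 2)"
  unfolding jacobiator_def fam_expand assms by (simp_all add: poly_expand)

lemma fam_jacobiator_rank4_123:
  assumes "a 1 = 0" "a 2 = 0" "a 4 = 0" "a 5 = 0" "a 6 = 0" "a 7 = 0" "a 8 = 0" "a 9 = - 2 * a 3"
  shows "fam_jacobiator a q1 q2 p1 p2 v 1 2 3 = 0"
  unfolding jacobiator_def fam_expand assms by (simp_all add: poly_expand)

text \<open>The assumptions leave a1, a2 and a3 free. They describe the linear span of all
  \<open>kepler_P3\<close> and \<open>kepler_P4\<close>, so any two of these bivectors are also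
  compatible with each other.\<close>

lemma fam_jacobiator_rank2_123:
  assumes "a 4 = 0" "a 7 = 0" "a 8 = 0" "a 9 = a 3" "a 5 = a 2" "a 6 = - a 1"
  shows "fam_jacobiator a q1 q2 p1 p2 v 1 2 3 = 0"
  unfolding jacobiator_def fam_expand assms by (simp_all add: poly_expand)

lemma fam_jacobiator_decomposable_124:
  assumes "a 3 = 0" "a 4 = 0" "a 5 = 0" "a 6 = 0" "a 7 = 0" "a 9 = 0"
  shows "fam_jacobiator a q1 q2 p1 p2 v 1 2 4 = p1 * (q1 * p2 - q2 * p1)\<^sup>2 * (a 1 * a 1 + a 2 * a 2)"
  unfolding jacobiator_def fam_expand assms by (simp_all add: poly_expand)

lemma fam_jacobiator_rank4_124:
  assumes "a 1 = 0" "a 2 = 0" "a 4 = 0" "a 5 = 0" "a 6 = 0" "a 7 = 0" "a 8 = 0" "a 9 = - 2 * a 3"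
  shows "fam_jacobiator a q1 q2 p1 p2 v 1 2 4 = 0"
  unfolding jacobiator_def fam_expand assms by (simp_all add: poly_expand)

lemma fam_jacobiator_rank2_124:
  assumes "a 4 = 0" "a 7 = 0" "a 8 = 0" "a 9 = a 3" "a 5 = a 2" "a 6 = - a 1"
  shows "fam_jacobiator a q1 q2 p1 p2 v 1 2 4 = 0"
  unfolding jacobiator_def fam_expand assms by (simp_all add: poly_expand)

lemma fam_jacobiator_decomposable_134:
  assumes "a 3 = 0" "a 4 = 0" "a 5 = 0" "a 6 = 0" "a 7 = 0" "a 9 = 0"
  shows "fam_jacobiator a q1 q2 p1 p2 v 1 3 4
      = - q2 * (v * (q1\<^sup>2 + q2\<^sup>2)) * (q1 * p2 - q2 * p1)\<^sup>2 * (a 1 * a 1 + a 2 * a 2)"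
  unfolding jacobiator_def fam_expand assms by (simp_all add: poly_expand)

lemma fam_jacobiator_rank4_134:
  assumes "a 1 = 0" "a 2 = 0" "a 4 = 0" "a 5 = 0" "a 6 = 0" "a 7 = 0" "a 8 = 0" "a 9 = - 2 * a 3"
  shows "fam_jacobiator a q1 q2 p1 p2 v 1 3 4 = 0"
  unfolding jacobiator_def fam_expand assms by (simp_all add: poly_expand)

lemma fam_jacobiator_rank2_134:
  assumes "a 4 = 0" "a 7 = 0" "a 8 = 0" "a 9 = a 3" "a 5 = a 2" "a 6 = - a 1"
  shows "fam_jacobiator a q1 q2 p1 p2 v 1 3 4 = 0"
  unfolding jacobiator_def fam_expand assms by (simp_all add: poly_expand)

lemma fam_jacobiator_decomposable_234:
  assumes "a 3 = 0" "a 4 = 0" "a 5 = 0" "a 6 = 0" "a 7 = 0" "a 9 = 0"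
  shows "fam_jacobiator a q1 q2 p1 p2 v 2 3 4
      = q1 * (v * (q1\<^sup>2 + q2\<^sup>2)) * (q1 * p2 - q2 * p1)\<^sup>2 * (a 1 * a 1 + a 2 * a 2)"
  unfolding jacobiator_def fam_expand assms by (simp_all add: poly_expand)

lemma fam_jacobiator_rank4_234:
  assumes "a 1 = 0" "a 2 = 0" "a 4 = 0" "a 5 = 0" "a 6 = 0" "a 7 = 0" "a 8 = 0" "a 9 = - 2 * a 3"
  shows "fam_jacobiator a q1 q2 p1 p2 v 2 3 4 = 0"
  unfolding jacobiator_def fam_expand assms by (simp_all add: poly_expand)

lemma fam_jacobiator_rank2_234:
  assumes "a 4 = 0" "a 7 = 0" "a 8 = 0" "a 9 = a 3" "a 5 = a 2" "a 6 = - a 1"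
  shows "fam_jacobiator a q1 q2 p1 p2 v 2 3 4 = 0"
  unfolding jacobiator_def fam_expand assms by (simp_all add: poly_expand)

subsection \<open>Invariance\<close>

definition kepler_X_pd :: "complex \<Rightarrow> complex \<Rightarrow> complex \<Rightarrow> 4 \<Rightarrow> complex ^ 4" where
  "kepler_X_pd q1 q2 v m = (let r2 = q1\<^sup>2 + q2\<^sup>2; dq1 = (if m = 1 then 1 else 0); dq2 = (if m
      = 2 then 1 else 0);
       dp1 = (if m = 3 then 1 else 0); dp2 = (if m = 4 then 1 else 0); dw
           = - 3 * v * (q1 * dq1 + q2 * dq2) in
     vector [dp1, dp2, - (dq1 * (v * r2) + q1 * dw), - (dq2 * (v * r2) + q2 * dw)])"

lemma kepler_X_eq:
  assumes "x \<in> phase_space"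
  shows "kepler_X \<kappa> x = vector [coord x 3, coord x 4,
    - (coord x 1 * radial \<kappa> 3 x), - (coord x 2 * radial \<kappa> 3 x)]"
  unfolding kepler_X_def canonical_apply[OF has_pds_kepler_H[OF assms]] by simp

lemma has_pds_kepler_X:
  assumes x: "x \<in> phase_space"
  shows "has_pds (\<lambda>y. kepler_X \<kappa> y $ i)
    (\<lambda>m. kepler_X_pd (coord x 1) (coord x 2) (radial \<kappa> 5 x) m $ i) x"
proof -
  have "\<forall>i. has_pds (\<lambda>y. (vector [coord y 3, coord y 4,
    - (coord y 1 * radial \<kappa> 3 y), - (coord y 2 * radial \<kappa> 3 y)] :: complex ^ 4) $ i)
    (\<lambda>m. kepler_X_pd (coord x 1) (coord x 2) (radial \<kappa> 5 x) m $ i) x"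
    unfolding forall_4 kepler_X_pd_def Let_def vector_4_nth
    apply (intro conjI; rule has_pds_eq_rhs, (rule has_pds_intros has_pds_radial[OF x])+)
    by (simp_all add: radial_relations[OF x] algebra_simps power2_eq_square)
  then have "has_pds (\<lambda>y. (vector [coord y 3, coord y 4,
    - (coord y 1 * radial \<kappa> 3 y), - (coord y 2 * radial \<kappa> 3 y)] :: complex ^ 4) $ i)
    (\<lambda>m. kepler_X_pd (coord x 1) (coord x 2) (radial \<kappa> 5 x) m $ i) x" by blast
  then show ?thesis
    by (rule has_pds_transform_open[OF _ open_phase_space x]) (simp add: kepler_X_eq)
qed

definition lie_jet :: "complex ^ 4 \<Rightarrow> (4 \<Rightarrow> complex ^ 4) \<Rightarrow> complex ^ 4 ^ 4 \<Rightarrow>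
    (4 \<Rightarrow> complex ^ 4 ^ 4) \<Rightarrow> 4 \<Rightarrow> 4 \<Rightarrow> complex" where
  "lie_jet X dX b D i j = (\<Sum>m\<in>UNIV. X $ m * D m $ i $ j - b $ m $ j * dX m $ i - b $ i $ m * dX m $ j)"

text \<open>The Lie derivative of a skew field is skew, so six components suffice.\<close>

lemma lie_jet_eq_0:
  assumes b: "transpose b = - b" and D: "\<And>m. transpose (D m) = - D m"
    and "lie_jet X dX b D 1 2 = 0" "lie_jet X dX b D 1 3 = 0" "lie_jet X dX b D 1 4 = 0"
        "lie_jet X dX b D 2 3 = 0" "lie_jet X dX b D 2 4 = 0" "lie_jet X dX b D 3 4 = 0"
  shows "lie_jet X dX b D i j = 0"
proof -
  let ?L = "lie_jet X dX b D"
  have sw: "?L j i = - ?L i j" for i j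
    unfolding lie_jet_def sum_negf[symmetric]
  proof (rule sum.cong)
    fix m
    show "X $ m * D m $ j $ i - b $ m $ i * dX m $ j - b $ j $ m * dX m $ i
        = - (X $ m * D m $ i $ j - b $ m $ j * dX m $ i - b $ i $ m * dX m $ j)"
      unfolding skew_entries(2)[OF D, of m j i] skew_entries(2)[OF b, of m i] skew_entries(2)[OF b, of j m]
      by (simp add: algebra_simps)
  qed simp
  have d: "?L i i = 0" for i
  proof -
    have "2 * ?L i i = 0" using sw[of i i] by algebra
    then show ?thesis by simp
  qed
  have "\<forall>i j. ?L i j = 0"
    unfolding forall_4 d sw[of 2 1] sw[of 3 1] sw[of 4 1] sw[of 3 2] sw[of 4 2] sw[of 4 3] 
    using assms(3-) by simp
  then show ?thesis by blast
qed

lemmas lie_expand = lie_jet_def kepler_X_pd_def vector_4_nth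

abbreviation fam_lie where
  "fam_lie a q1 q2 p1 p2 v \<equiv> lie_jet (vector [p1, p2, - (q1 * (v * (q1\<^sup>2 + q2\<^sup>2))), - (q2 * (v * (q1\<^sup>2
      + q2\<^sup>2)))])
     (kepler_X_pd q1 q2 v)
     (fam_matrix a q1 q2 p1 p2 (v * (q1\<^sup>2 + q2\<^sup>2)\<^sup>2) (v * (q1\<^sup>2 + q2\<^sup>2))) (fam_pd a q1 q2 p1 p2 v)"

text \<open>H, K1, K2 and K3 are first integrals, so P, their Hamiltonian fields and all
  combinations of these are invariant. \<open>kepler_Pt\<close> is not built from such pieces;
  direct expansion treats all nine terms alike.\<close>

lemma fam_lie_12: "fam_lie a q1 q2 p1 p2 v 1 2 = 0"
  unfolding lie_expand fam_expand by (simp add: poly_expand)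

lemma fam_lie_13: "fam_lie a q1 q2 p1 p2 v 1 3 = 0"
  unfolding lie_expand fam_expand by (simp add: poly_expand)

lemma fam_lie_14: "fam_lie a q1 q2 p1 p2 v 1 4 = 0"
  unfolding lie_expand fam_expand by (simp add: poly_expand)

lemma fam_lie_23: "fam_lie a q1 q2 p1 p2 v 2 3 = 0"
  unfolding lie_expand fam_expand by (simp add: poly_expand)

lemma fam_lie_24: "fam_lie a q1 q2 p1 p2 v 2 4 = 0"
  unfolding lie_expand fam_expand by (simp add: poly_expand)

lemma fam_lie_34: "fam_lie a q1 q2 p1 p2 v 3 4 = 0"
  unfolding lie_expand fam_expand by (simp add: poly_expand)

lemma lie_bivector_eq_lie_jet:
  assumes "\<And>i j. has_pds (\<lambda>y. B y $ i $ j) (\<lambda>m. D m $ i $ j) x" "\<And>i. has_pds (\<lambda>y. X y $ i) (\<lambda>m. dX m $ i) x"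
  shows "lie_bivector X B x $ i $ j = lie_jet (X x) dX (B x) D i j"
  by (simp add: lie_bivector_def lie_jet_def has_pds_imp_pd[OF assms(1)] has_pds_imp_pd[OF assms(2)])

lemma invariant_kepler_family: "invariant_bivector_on phase_space (kepler_X \<kappa>) (kepler_family \<kappa> a)"
  unfolding invariant_bivector_on_def
proof
  fix x assume x: "x \<in> phase_space"
  have "lie_bivector (kepler_X \<kappa>) (kepler_family \<kappa> a) x $ i $ j = 0" for i j
    unfolding lie_bivector_eq_lie_jet[OF has_pds_kepler_family[OF x] has_pds_kepler_X[OF x]]
      kepler_X_eq[OF x] kepler_family_eq[OF x] radial_relations[OF x]
    by (rule lie_jet_eq_0[OF transpose_fam_matrix transpose_fam_pd fam_lie_12 fam_lie_13 fam_lie_14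
        fam_lie_23 fam_lie_24 fam_lie_34])
  then show "lie_bivector (kepler_X \<kappa>) (kepler_family \<kappa> a) x = 0"
    by (simp add: vec_eq_iff)
qed

lemma skew_kepler_family: "skew_field_on phase_space (kepler_family \<kappa> a)"
  unfolding skew_field_on_def
proof (intro ballI conjI allI)
  fix x i j assume x: "x \<in> phase_space"
  show "transpose (kepler_family \<kappa> a x) = - kepler_family \<kappa> a x"
    unfolding kepler_family_eq[OF x] by (rule transpose_fam_matrix)
  show "(\<lambda>y. kepler_family \<kappa> a y $ i $ j) differentiable at x"
    by (rule has_pds_imp_differentiable[OF has_pds_kepler_family[OF x]])
qed

lemma schouten_kepler_family:
  assumes x: "x \<in> phase_space"
  shows "schouten (kepler_family \<kappa> a) (kepler_family \<kappa> a) i j k x = - 2 * fam_jacobiator a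
    (coord x 1) (coord x 2) (coord x 3) (coord x 4)
    (radial \<kappa> 5 x) i j k"
  unfolding schouten_self[OF has_pds_kepler_family[OF x]] kepler_family_eq[OF x] radial_relations[OF x]
      by simp

lemma poisson_kepler_familyI:
  assumes "a 3 = 0 \<and> a 4 = 0 \<and> a 5 = 0 \<and> a 6 = 0 \<and> a 7 = 0 \<and> a 9 = 0 \<and> a 1 * a 1 + a 2 * a 2 = 0
    \<or> a 1 = 0 \<and> a 2 = 0 \<and> a 4 = 0 \<and> a 5 = 0 \<and> a 6 = 0 \<and> a 7 = 0 \<and> a 8 = 0 \<and> a 9 = - 2 * a 3
    \<or> a 4 = 0 \<and> a 7 = 0 \<and> a 8 = 0 \<and> a 9 = a 3 \<and> a 5 = a 2 \<and> a 6 = - a 1"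
  shows "poisson_on phase_space (kepler_family \<kappa> a)"
proof -
  have "fam_jacobiator a q1 q2 p1 p2 v i j k = 0" for q1 q2 p1 p2 v i j k
    using assms
  proof (elim disjE)
    assume h: "a 3 = 0 \<and> a 4 = 0 \<and> a 5 = 0 \<and> a 6 = 0 \<and> a 7 = 0 \<and> a 9 = 0 \<and> a 1 * a 1 + a 2 * a 2 = 0"
    show ?thesis
      by (rule jacobiator_eq_0[OF transpose_fam_pd])
        (use h in \<open>simp_all add: fam_jacobiator_decomposable_123 fam_jacobiator_decomposable_124
          fam_jacobiator_decomposable_134 fam_jacobiator_decomposable_234\<close>)
  next
    assume h: "a 1 = 0 \<and> a 2 = 0 \<and> a 4 = 0 \<and> a 5 = 0 \<and> a 6 = 0 \<and> a 7 = 0 \<and> a 8 = 0 \<and> a 9 = - 2 * a 3"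
    show ?thesis
      by (rule jacobiator_eq_0[OF transpose_fam_pd])
        (use h in \<open>simp_all add: fam_jacobiator_rank4_123 fam_jacobiator_rank4_124
          fam_jacobiator_rank4_134 fam_jacobiator_rank4_234\<close>)
  next
    assume h: "a 4 = 0 \<and> a 7 = 0 \<and> a 8 = 0 \<and> a 9 = a 3 \<and> a 5 = a 2 \<and> a 6 = - a 1"
    show ?thesis
      by (rule jacobiator_eq_0[OF transpose_fam_pd])
        (use h in \<open>simp_all add: fam_jacobiator_rank2_123 fam_jacobiator_rank2_124
          fam_jacobiator_rank2_134 fam_jacobiator_rank2_234\<close>)
  qed
  then show ?thesis
    using skew_kepler_family by (simp add: poisson_on_def schouten_kepler_family)
qed

subsection \<open>The Jacobi identity: necessary conditions\<close>

text \<open>Positive arguments are infinitely many already, and for positive \<open>l\<close> the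
  radius at an axis point is \<open>l\<close> itself.\<close>

lemma poly_eq_0_if_zero_on_positive_reals:
  fixes p :: "complex poly"
  assumes "\<And>t::real. t > 0 \<Longrightarrow> poly p (complex_of_real t) = 0"
  shows "p = 0"
proof (rule ccontr)
  assume "p \<noteq> 0"
  then have "finite {z. poly p z = 0}" by (rule poly_roots_finite)
  moreover have "complex_of_real ` {0<..} \<subseteq> {z. poly p z = 0}" using assms by auto
  ultimately have "finite (complex_of_real ` {0<..})" by (rule rev_finite_subset)
  then have "finite {0::real<..}" by (rule finite_imageD) (simp add: inj_on_def)
  then show False by (simp add: infinite_Ioi)
qed

text \<open>Here momentum is orthogonal to position and both lie along coordinate axes. Most
  monomials vanish while K3 = - l t does not, and what remains is a cubic in
  \<open>t\<close>.\<close>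

lemma fam_jacobiator_axis2_123:
  "fam_jacobiator a 0 l t 0 v 1 2 3 = poly [: 0,
     v * l ^ 5 * a 6 * (a 9 - a 3) + l * a 6 * a 8 + v * l ^ 6 * a 6 * (a 2 - a 5),
     - (l ^ 2 * a 6 * a 7),
     l * a 6 * (a 3 - a 9) / 2 + l ^ 2 * a 6 * (a 5 - a 2) + l ^ 3 * a 4 * a 6 :] t"
  unfolding jacobiator_def fam_expand by (simp add: poly_expand power_numeral_reduce)

lemma fam_jacobiator_axis2_124:
  "fam_jacobiator a 0 l t 0 v 1 2 4 = poly [:
     v * l ^ 5 * a 7 * (a 9 - a 3) + l * a 7 * a 8 + v * l ^ 6 * a 7 * (a 2 - a 5),
     v * l ^ 4 * (a 3 ^ 2 - a 3 * a 9 / 2 - a 9 ^ 2 / 2) + (a 8 * a 9 / 2 - a 3 * a 8)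
       + v * l ^ 5 * (3 * a 3 * a 5 - a 2 * a 9 / 2 - 5 * a 5 * a 9 / 2)
       - 2 * l * a 5 * a 8 + v * l ^ 6 * (2 * a 5 ^ 2 - 2 * a 2 * a 5 + 2 * a 3 * a 4 - 2 * a 4 * a 9)
       - l ^ 2 * (2 * a 4 * a 8 + a 7 ^ 2) + v * l ^ 7 * (2 * a 4 * a 5 - 2 * a 2 * a 4),
     l * (3 / 2) * a 7 * (a 3 - a 9) + l ^ 2 * a 7 * (3 * a 5 - a 2) + 3 * l ^ 3 * a 4 * a 7,
     a 9 ^ 2 / 4 + a 3 * a 9 / 4 - a 3 ^ 2 / 2 + l * (a 2 * a 9 / 2 - 2 * a 3 * a 5 + 3 * a 5 * a 9 / 2)
       + l ^ 2 * (a 1 ^ 2 + a 1 * a 6 + a 2 ^ 2 + a 2 * a 5 - 2 * a 3 * a 4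
           + 5 * a 4 * a 9 / 2 - 2 * a 5 ^ 2)
       + l ^ 3 * (2 * a 2 * a 4 - 4 * a 4 * a 5) - 2 * l ^ 4 * a 4 ^ 2 :] t"
  unfolding jacobiator_def fam_expand by (simp add: poly_expand power_numeral_reduce)

lemma fam_jacobiator_axis1_123:
  "fam_jacobiator a l 0 0 t v 1 2 3 = poly [:
     v * l ^ 5 * a 7 * (a 9 - a 3) + l * a 7 * a 8 + v * l ^ 6 * a 7 * (a 1 + a 6),
     v * l ^ 4 * (a 3 * a 9 / 2 - a 3 ^ 2 + a 9 ^ 2 / 2) + (a 3 * a 8 - a 8 * a 9 / 2)
       + v * l ^ 5 * (a 1 * a 9 / 2 + 3 * a 3 * a 6 - 5 * a 6 * a 9 / 2)
       - 2 * l * a 6 * a 8 + v * l ^ 6 * (2 * a 4 * a 9 - 2 * a 1 * a 6 - 2 * a 3 * a 4 - 2 * a 6 ^ 2)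
       + l ^ 2 * (2 * a 4 * a 8 + a 7 ^ 2) + v * l ^ 7 * (2 * a 1 * a 4 + 2 * a 4 * a 6),
     l * (3 / 2) * a 7 * (a 3 - a 9) - l ^ 2 * a 7 * (a 1 + 3 * a 6) + 3 * l ^ 3 * a 4 * a 7,
     a 3 ^ 2 / 2 - a 3 * a 9 / 4 - a 9 ^ 2 / 4 + l * (3 * a 6 * a 9 / 2 - a 1 * a 9 / 2 - 2 * a 3 * a 6)
       + l ^ 2 * (a 1 * a 6 - a 1 ^ 2 - a 2 ^ 2 + a 2 * a 5 + 2 * a 3 * a 4 - 5 * a 4 * a 9 / 2
           + 2 * a 6 ^ 2)
       - l ^ 3 * (2 * a 1 * a 4 + 4 * a 4 * a 6) + 2 * l ^ 4 * a 4 ^ 2 :] t"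
  unfolding jacobiator_def fam_expand by (simp add: poly_expand power_numeral_reduce)

lemma fam_jacobiator_axis1_124:
  "fam_jacobiator a l 0 0 t v 1 2 4 = poly [: 0,
     v * l ^ 5 * a 5 * (a 9 - a 3) + l * a 5 * a 8 + v * l ^ 6 * a 5 * (a 1 + a 6),
     l ^ 2 * a 5 * a 7,
     l * a 5 * (a 3 - a 9) / 2 - l ^ 2 * a 5 * (a 1 + a 6) + l ^ 3 * a 4 * a 5 :] t"
  unfolding jacobiator_def fam_expand by (simp add: poly_expand power_numeral_reduce)

text \<open>Coefficients are compared in \<open>t\<close> at fixed \<open>l\<close>, and then in
  \<open>l\<close>. The resulting equations are combined so that kappa cancels.\<close>

lemma poisson_kepler_familyD:
  assumes poisson: "poisson_on phase_space (kepler_family \<kappa> a)"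
  shows "a 3 = 0 \<and> a 4 = 0 \<and> a 5 = 0 \<and> a 6 = 0 \<and> a 7 = 0 \<and> a 9 = 0 \<and> a 1 * a 1 + a 2 * a 2 = 0
    \<or> a 1 = 0 \<and> a 2 = 0 \<and> a 4 = 0 \<and> a 5 = 0 \<and> a 6 = 0 \<and> a 7 = 0 \<and> a 8 = 0 \<and> a 9 = - 2 * a 3
    \<or> a 4 = 0 \<and> a 7 = 0 \<and> a 8 = 0 \<and> a 9 = a 3 \<and> a 5 = a 2 \<and> a 6 = - a 1"
proof -
  define k where "k = complex_of_real \<kappa>"
  have J0: "fam_jacobiator a (coord x 1) (coord x 2) (coord x 3)
      (coord x 4) (radial \<kappa> 5 x) i j m = 0" if "x \<in> phase_space" for x i j m
    using poisson schouten_kepler_family[OF that, of \<kappa> a i j m] that by (simp add: poisson_on_def)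
  define v where "v l = k / complex_of_real l ^ 5" for l
  have ax2: "fam_jacobiator a 0 (complex_of_real l) (complex_of_real t) 0 (v l) i j m = 0"
      if "l > 0" for l t i j m
    using J0[of "vector [0, l, t, 0]" i j m] that
        by (simp add: vector_4_nth phase_space_def radial_def v_def k_def)
  have ax1: "fam_jacobiator a (complex_of_real l) 0 0 (complex_of_real t) (v l) i j m = 0"
      if "l > 0" for l t i j m
    using J0[of "vector [l, 0, 0, t]" i j m] that
        by (simp add: vector_4_nth phase_space_def radial_def v_def k_def)
  note P0 = poly_eq_0_if_zero_on_positive_reals
  have C1: "of_real l * a 6 * (a 3 - a 9) / 2 + of_real l ^ 2 * a 6 * (a 5 - a 2)
      + of_real l ^ 3 * a 4 * a 6 = 0"
       "v l * of_real l ^ 5 * a 6 * (a 9 - a 3) + of_real l * a 6 * a 8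
           + v l * of_real l ^ 6 * a 6 * (a 2 - a 5) = 0"
    if "l > 0" for l
    using P0[OF ax2[OF that, where i=1 and j=2 and m=3, unfolded fam_jacobiator_axis2_123]] by simp_all
  have C2: "v l * of_real l ^ 4 * (a 3 ^ 2 - a 3 * a 9 / 2 - a 9 ^ 2 / 2) + (a 8 * a 9 / 2 - a 3 * a 8)
       + v l * of_real l ^ 5 * (3 * a 3 * a 5 - a 2 * a 9 / 2 - 5 * a 5 * a 9 / 2)
       - 2 * of_real l * a 5 * a 8 + v l * of_real l ^ 6 * (2 * a 5 ^ 2 - 2 * a 2 * a 5
           + 2 * a 3 * a 4 - 2 * a 4 * a 9)
       - of_real l ^ 2 * (2 * a 4 * a 8 + a 7 ^ 2) + v l * of_real l ^ 7 * (2 * a 4 * a 5 - 2 * a 2 * a 4)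
           = 0"
     "a 9 ^ 2 / 4 + a 3 * a 9 / 4 - a 3 ^ 2 / 2 + of_real l * (a 2 * a 9 / 2 - 2 * a 3 * a 5
         + 3 * a 5 * a 9 / 2)
       + of_real l ^ 2 * (a 1 ^ 2 + a 1 * a 6 + a 2 ^ 2 + a 2 * a 5 - 2 * a 3 * a 4
           + 5 * a 4 * a 9 / 2 - 2 * a 5 ^ 2)
       + of_real l ^ 3 * (2 * a 2 * a 4 - 4 * a 4 * a 5) - 2 * of_real l ^ 4 * a 4 ^ 2 = 0"
    if "l > 0" for l
    using P0[OF ax2[OF that, where i=1 and j=2 and m=4, unfolded fam_jacobiator_axis2_124]]
    unfolding pCons_eq_0_iff by blast+
  have C3: "a 3 ^ 2 / 2 - a 3 * a 9 / 4 - a 9 ^ 2 / 4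
      + of_real l * (3 * a 6 * a 9 / 2 - a 1 * a 9 / 2 - 2 * a 3 * a 6)
       + of_real l ^ 2 * (a 1 * a 6 - a 1 ^ 2 - a 2 ^ 2 + a 2 * a 5 + 2 * a 3 * a 4 - 5 * a 4 * a 9 / 2
           + 2 * a 6 ^ 2)
       - of_real l ^ 3 * (2 * a 1 * a 4 + 4 * a 4 * a 6) + 2 * of_real l ^ 4 * a 4 ^ 2 = 0"
    if "l > 0" for l
    using P0[OF ax1[OF that, where i=1 and j=2 and m=3, unfolded fam_jacobiator_axis1_123]]
    unfolding pCons_eq_0_iff by blast
  have C4: "v l * of_real l ^ 5 * a 5 * (a 9 - a 3) + of_real l * a 5 * a 8
      + v l * of_real l ^ 6 * a 5 * (a 1 + a 6) = 0"
     "of_real l * a 5 * (a 3 - a 9) / 2 - of_real l ^ 2 * a 5 * (a 1 + a 6) + of_real l ^ 3 * a 4 * a 5 = 0"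
    if "l > 0" for l
    using P0[OF ax1[OF that, where i=1 and j=2 and m=4, unfolded fam_jacobiator_axis1_124]] by simp_all
  have vl: "v l * of_real l ^ 4 * of_real l = k" "v l * of_real l ^ 5 = k" "v l * of_real l ^ 6
      = k * of_real l"
      "v l * of_real l ^ 7 = k * of_real l ^ 2" if "l > 0" for l
    using that by (simp_all add: v_def field_simps power_numeral_reduce)

  \<comment> \<open>The cubic coefficient in \<open>t\<close> contains no \<open>v\<close>, so it is
    a polynomial in \<open>l\<close> as it stands.\<close>
  have "[: a 9 ^ 2 / 4 + a 3 * a 9 / 4 - a 3 ^ 2 / 2, a 2 * a 9 / 2 - 2 * a 3 * a 5 + 3 * a 5 * a 9 / 2,
      a 1 ^ 2 + a 1 * a 6 + a 2 ^ 2 + a 2 * a 5 - 2 * a 3 * a 4 + 5 * a 4 * a 9 / 2 - 2 * a 5 ^ 2,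
      2 * a 2 * a 4 - 4 * a 4 * a 5, - 2 * a 4 ^ 2 :] = 0"
    by (rule P0, drule C2(2)) (simp add: poly_expand power_numeral_reduce)
  then have E1: "a 9 ^ 2 / 4 + a 3 * a 9 / 4 - a 3 ^ 2 / 2
      = 0" "a 2 * a 9 / 2 - 2 * a 3 * a 5 + 3 * a 5 * a 9 / 2 = 0"
      "a 1 ^ 2 + a 1 * a 6 + a 2 ^ 2 + a 2 * a 5 - 2 * a 3 * a 4 + 5 * a 4 * a 9 / 2 - 2 * a 5 ^ 2 = 0"
          and a4: "- 2 * a 4 ^ 2 = 0"
    unfolding pCons_eq_0_iff by blast+
  have a4: "a 4 = 0" using a4 by simp
  have "[: a 3 ^ 2 / 2 - a 3 * a 9 / 4 - a 9 ^ 2 / 4, 3 * a 6 * a 9 / 2 - a 1 * a 9 / 2 - 2 * a 3 * a 6,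
      a 1 * a 6 - a 1 ^ 2 - a 2 ^ 2 + a 2 * a 5 + 2 * a 3 * a 4 - 5 * a 4 * a 9 / 2 + 2 * a 6 ^ 2,
      - (2 * a 1 * a 4 + 4 * a 4 * a 6), 2 * a 4 ^ 2 :] = 0"
    by (rule P0, drule C3) (simp add: poly_expand power_numeral_reduce)
  then have E2: "3 * a 6 * a 9 / 2 - a 1 * a 9 / 2 - 2 * a 3 * a 6 = 0"
      "a 1 * a 6 - a 1 ^ 2 - a 2 ^ 2 + a 2 * a 5 + 2 * a 3 * a 4 - 5 * a 4 * a 9 / 2 + 2 * a 6 ^ 2 = 0"
    unfolding pCons_eq_0_iff by blast+
  have "[: 0, a 6 * (a 3 - a 9) / 2, a 6 * (a 5 - a 2), a 4 * a 6 :] = 0"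
    by (rule P0, drule C1(1)) (simp add: poly_expand power_numeral_reduce)
  then have E3: "a 6 * (a 3 - a 9) = 0" "a 6 * (a 5 - a 2) = 0" by simp_all
  have "[: 0, a 5 * (a 3 - a 9) / 2, - (a 5 * (a 1 + a 6)), a 4 * a 5 :] = 0"
    by (rule P0, drule C4(2)) (simp add: poly_expand power_numeral_reduce)
  then have E4: "a 5 * (a 3 - a 9) = 0" "a 5 * (a 1 + a 6) = 0" by simp_all
  \<comment> \<open>At l = 1 the terms with \<open>v 1\<close> vanish by the relations just found,
    which isolates the products with \<open>a 8\<close>.\<close>
  have "v 1 * a 6 * (a 9 - a 3) + a 6 * a 8 + v 1 * a 6 * (a 2 - a 5) = 0"
    "v 1 * a 5 * (a 9 - a 3) + a 5 * a 8 + v 1 * a 5 * (a 1 + a 6) = 0"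
    using C1(2)[of 1] C4(1)[of 1] by simp_all
  then have E5: "a 6 * a 8 = 0" "a 5 * a 8 = 0"
    using E3 E4 by algebra+
  have "[: k * (a 3 ^ 2 - a 3 * a 9 / 2 - a 9 ^ 2 / 2), 
      (a 8 * a 9 / 2 - a 3 * a 8) + k * (3 * a 3 * a 5 - a 2 * a 9 / 2 - 5 * a 5 * a 9 / 2),
      - 2 * a 5 * a 8 + k * (2 * a 5 ^ 2 - 2 * a 2 * a 5),
      - (a 7 ^ 2) :] = 0"
  proof (rule P0)
    fix l :: real assume l: "l > 0"
    note e = C2(1)[OF l, unfolded vl[OF l] a4]
    \<comment> \<open>The lowest term carries v l^4 = k / l, so multiplication by \<open>l\<close>
      is what makes the relation a polynomial.\<close>
    from arg_cong[OF e, of "\<lambda>z. z * of_real l"]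
    have "v l * of_real l ^ 4 * of_real l * (a 3 ^ 2 - a 3 * a 9 / 2 - a 9 ^ 2 / 2)
       + of_real l * ((a 8 * a 9 / 2 - a 3 * a 8)
       + k * (3 * a 3 * a 5 - a 2 * a 9 / 2 - 5 * a 5 * a 9 / 2))
       - of_real l ^ 2 * (2 * a 5 * a 8) + of_real l ^ 2 * k * (2 * a 5 ^ 2 - 2 * a 2 * a 5)
       - of_real l ^ 3 * a 7 ^ 2 = 0"
      by (simp add: poly_expand)
    then show "poly [: k * (a 3 ^ 2 - a 3 * a 9 / 2 - a 9 ^ 2 / 2), 
      (a 8 * a 9 / 2 - a 3 * a 8) + k * (3 * a 3 * a 5 - a 2 * a 9 / 2 - 5 * a 5 * a 9 / 2),
      - 2 * a 5 * a 8 + k * (2 * a 5 ^ 2 - 2 * a 2 * a 5),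
      - (a 7 ^ 2) :] (of_real l) = 0"
      unfolding vl[OF l] by (simp add: poly_expand)
  qed
  then have E6: "(a 8 * a 9 / 2 - a 3 * a 8) + k * (3 * a 3 * a 5 - a 2 * a 9 / 2 - 5 * a 5 * a 9 / 2)
      = 0" "a 7 = 0"
    unfolding pCons_eq_0_iff by simp_all
  \<comment> \<open>Four times the quadratic form is (a9 - a3)(a9 + 2 a3), which separates the two
    possible ratios of \<open>a 9\<close> to \<open>a 3\<close>.\<close>
  have F1: "(a 3 - a 9) * (2 * a 3 + a 9) = 0" using E1(1) by algebra
  have F2: "a 2 * a 9 = 4 * a 3 * a 5 - 3 * a 5 * a 9" using E1(2) by algebra
  have F3: "a 1 * a 9 = 3 * a 6 * a 9 - 4 * a 3 * a 6" using E2(1) by algebra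
  have F4: "a 1 ^ 2 + a 1 * a 6 + a 2 ^ 2 + a 2 * a 5 = 2 * a 5 ^ 2" using E1(3) a4 by simp
  have F5: "a 1 ^ 2 - a 1 * a 6 + a 2 ^ 2 - a 2 * a 5 = 2 * a 6 ^ 2" using E2(2) a4 by algebra
  \<comment> \<open>Substituting \<open>F2\<close> turns the factor of \<open>k\<close> into a5 (a3
    - a9), which is zero by \<open>E4\<close>.\<close>
  have F6: "a 8 * (2 * a 3 - a 9) = 0" using E6(1) F2 E4(1) by algebra
  show ?thesis
  \<comment> \<open>If either parameter is nonzero, then a3 = a9 and a8 = 0, which points to the
    linear component. If both vanish, \<open>F4\<close> becomes the quadric a1^2 + a2^2 = 0.\<close>
  proof (cases "a 5 = 0 \<and> a 6 = 0")
    case True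
    then have s: "a 1 * a 1 + a 2 * a 2 = 0" using F4 by (simp add: power2_eq_square)
    show ?thesis
    proof (cases "a 9 = 0")
      case True': True
      then show ?thesis using True F1 s a4 E6(2) by simp
    next
      case False
      then have z: "a 1 = 0" "a 2 = 0" using F2 F3 True by simp_all
      have "a 3 = a 9 \<or> a 9 = - 2 * a 3" using F1 by (auto simp: add_eq_0_iff)
      then show ?thesis
      proof
        assume "a 3 = a 9" then show ?thesis using z True F6 False a4 E6(2) by simp
      next
        assume h: "a 9 = - 2 * a 3"
        then have "a 8 = 0" using F6 False by simp
        then show ?thesis using h z True a4 E6(2) by simp
      qed
    qed
  next
    case False
    then have "a 3 = a 9" "a 8 = 0" using E3 E4 E5 by auto
    moreover have "a 5 = a 2 \<and> a 6 = - a 1"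
    proof (cases "a 5 = 0")
      case True
      then have "a 6 \<noteq> 0" using False by simp
      then have "a 2 = 0" using E3(2) True by simp
      \<comment> \<open>Half the difference of \<open>F4\<close> and \<open>F5\<close>.\<close>
      then have "(a 1 + a 6) * a 6 = 0" using F4 F5 True by algebra
      then show ?thesis using \<open>a 6 \<noteq> 0\<close> \<open>a 2 = 0\<close> True by (simp add: add_eq_0_iff)
    next
      case a5: False
      then have a1: "a 1 = - a 6" using E4(2) by (simp add: add_eq_0_iff2)
      show ?thesis
      proof (cases "a 6 = 0")
        case True
        then have "(a 2 - a 5) * a 5 = 0" using F4 F5 a1 by algebra
        then show ?thesis using a5 a1 True by simp
      next
        case False then show ?thesis using E3(2) a1 by simp
      qed
    qed
    ultimately show ?thesis using a4 E6(2) by simp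
  qed
qed

subsection \<open>The four bivectors\<close>

lemmas bivector_expand = kepler_family_def kepler_P1_def kepler_P1_conj_def kepler_P2_def kepler_P3_def
    kepler_P4_def
  wedge_def cscale_def

definition P1_params :: "complex \<Rightarrow> complex \<Rightarrow> nat \<Rightarrow> complex" where
  "P1_params a b = (\<lambda>n. if n = 1 then a else if n = 2 then \<i> * a else if n = 8 then b else 0)"

definition P1_conj_params :: "complex \<Rightarrow> complex \<Rightarrow> nat \<Rightarrow> complex" where
  "P1_conj_params a b = (\<lambda>n. if n = 1 then a else if n = 2 then - \<i> * a else if n = 8 then b else 0)"

definition P2_params :: "complex \<Rightarrow> nat \<Rightarrow> complex" where
  "P2_params a = (\<lambda>n. if n = 3 then a else if n = 9 then - 2 * a else 0)"

text \<open>One parametrisation of the whole linear component: \<open>a\<close> and \<open>b\<close>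
  weight the parts special to P3 and P4, \<open>c\<close> the summand H P plus
  \<open>kepler_Pt\<close> common to both.\<close>

definition P34_params :: "complex \<Rightarrow> complex \<Rightarrow> complex \<Rightarrow> nat \<Rightarrow> complex" where
  "P34_params a b c = (\<lambda>n. if n = 1 then a else if n = 6 then - a else if n = 2 \<or> n = 5 then b else if n
      = 3 \<or> n = 9 then c else 0)"

lemmas params_defs = P1_params_def P1_conj_params_def P2_params_def P34_params_def

lemma kepler_P1_eq_family: "kepler_P1 \<kappa> a b = kepler_family \<kappa> (P1_params a b)"
  by (simp add: fun_eq_iff vec_eq_iff bivector_expand params_defs algebra_simps)

lemma kepler_P1_conj_eq_family: "kepler_P1_conj \<kappa> a b = kepler_family \<kappa> (P1_conj_params a b)"
  by (simp add: fun_eq_iff vec_eq_iff bivector_expand params_defs algebra_simps)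

lemma kepler_P2_eq_family: "kepler_P2 \<kappa> a = kepler_family \<kappa> (P2_params a)"
  by (simp add: fun_eq_iff vec_eq_iff bivector_expand params_defs algebra_simps)

lemma kepler_P3_eq_family: "kepler_P3 \<kappa> a b = kepler_family \<kappa> (P34_params a 0 b)"
  by (simp add: fun_eq_iff vec_eq_iff bivector_expand params_defs algebra_simps)

lemma kepler_P4_eq_family: "kepler_P4 \<kappa> a b = kepler_family \<kappa> (P34_params 0 a b)"
  by (simp add: fun_eq_iff vec_eq_iff bivector_expand params_defs algebra_simps)

lemma kepler_P3_plus_P4_eq_family:
  "kepler_P3 \<kappa> a b x + kepler_P4 \<kappa> c d x = kepler_family \<kappa> (P34_params a c (b + d)) x"
  by (simp add: vec_eq_iff bivector_expand params_defs algebra_simps)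

lemma kepler_family_cong:
  assumes "\<And>n. n \<in> {1..9} \<Longrightarrow> a n = b n"
  shows "kepler_family \<kappa> a = kepler_family \<kappa> b"
  using assms by (simp add: fun_eq_iff kepler_family_def)

text \<open>The classification asserts equality of fields only on the phase space; openness lets
  derivatives agree there too.\<close>

lemma poisson_on_cong:
  assumes "open U" and eq: "\<And>x. x \<in> U \<Longrightarrow> A x = B x"
  shows "poisson_on U A = poisson_on U B"
proof -
  have pd: "pd m (\<lambda>y. A y $ i $ j) x = pd m (\<lambda>y. B y $ i $ j) x" if "x \<in> U" for m i j x
    using assms that by (intro pd_cong_open[of U]) auto
  have "(\<lambda>y. A y $ i $ j) differentiable at x \<longleftrightarrow> (\<lambda>y. B y $ i $ j) differentiable at x" if "x \<in> U" for i j x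
    unfolding differentiable_def
    using has_derivative_transform_within_open[OF _ assms(1) that, of "\<lambda>y. A y $ i $ j" _ UNIV "\<lambda>y. B y $ i
        $ j"]
      has_derivative_transform_within_open[OF _ assms(1) that, of "\<lambda>y. B y $ i $ j" _ UNIV "\<lambda>y. A y $ i $
          j"] eq
    by auto
  then show ?thesis
    unfolding poisson_on_def skew_field_on_def schouten_def using eq pd by simp
qed

lemma poisson_kepler_family_iff:
  "poisson_on phase_space (kepler_family \<kappa> a) \<longleftrightarrow>
        (\<exists>\<alpha> \<beta>. \<forall>x\<in>phase_space. kepler_family \<kappa> a x = kepler_P1 \<kappa> \<alpha> \<beta> x) \<or>
        (\<exists>\<alpha> \<beta>. \<forall>x\<in>phase_space. kepler_family \<kappa> a x = kepler_P1_conj \<kappa> \<alpha> \<beta> x) \<or>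
        (\<exists>\<alpha>. \<forall>x\<in>phase_space. kepler_family \<kappa> a x = kepler_P2 \<kappa> \<alpha> x) \<or>
        (\<exists>\<alpha> \<beta> \<gamma> \<delta>. \<forall>x\<in>phase_space.
            kepler_family \<kappa> a x = kepler_P3 \<kappa> \<alpha> \<beta> x + kepler_P4 \<kappa> \<gamma> \<delta> x)" (is "?L \<longleftrightarrow> ?R")
proof
  have nine: "{1..9::nat} = {1, 2, 3, 4, 5, 6, 7, 8, 9}" by auto
  assume ?L
  from poisson_kepler_familyD[OF this] show ?R
  proof (elim disjE)
    assume h: "a 3 = 0 \<and> a 4 = 0 \<and> a 5 = 0 \<and> a 6 = 0 \<and> a 7 = 0 \<and> a 9 = 0 \<and> a 1 * a 1 + a 2 * a 2 = 0"
    then have "(a 2 - \<i> * a 1) * (a 2 + \<i> * a 1) = 0" by (simp add: algebra_simps)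
    then have "a 2 = \<i> * a 1 \<or> a 2 = - \<i> * a 1" by (auto simp: add_eq_0_iff2)
    then show ?R
    proof
      assume "a 2 = \<i> * a 1"
      then have "kepler_family \<kappa> a = kepler_P1 \<kappa> (a 1) (a 8)"
        unfolding kepler_P1_eq_family using h by (intro kepler_family_cong) (auto simp: nine params_defs)
      then show ?R by metis
    next
      assume "a 2 = - \<i> * a 1"
      then have "kepler_family \<kappa> a = kepler_P1_conj \<kappa> (a 1) (a 8)"
        unfolding kepler_P1_conj_eq_family using h
            by (intro kepler_family_cong) (auto simp: nine params_defs)
      then show ?R by metis
    qed
  next
    assume h: "a 1 = 0 \<and> a 2 = 0 \<and> a 4 = 0 \<and> a 5 = 0 \<and> a 6 = 0 \<and> a 7 = 0 \<and> a 8 = 0 \<and> a 9 = - 2 * a 3"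
    then have "kepler_family \<kappa> a = kepler_P2 \<kappa> (a 3)"
      unfolding kepler_P2_eq_family by (intro kepler_family_cong) (auto simp: nine params_defs)
    then show ?R by metis
  next
    assume h: "a 4 = 0 \<and> a 7 = 0 \<and> a 8 = 0 \<and> a 9 = a 3 \<and> a 5 = a 2 \<and> a 6 = - a 1"
    \<comment> \<open>The common summand can be split between P3 and P4 at will; all of it goes to
      P3, hence \<open>a 3 + 0\<close>.\<close>
    then have "kepler_family \<kappa> a = kepler_family \<kappa> (P34_params (a 1) (a 2) (a 3 + 0))"
      by (intro kepler_family_cong) (auto simp: nine params_defs)
    then have "\<forall>x\<in>phase_space. kepler_family \<kappa> a x = kepler_P3 \<kappa> (a 1) (a 3) x + kepler_P4 \<kappa> (a 2) 0 x"
      unfolding kepler_P3_plus_P4_eq_family by simp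
    then show ?R by blast
  qed
next
  assume ?R
  then obtain c where "\<forall>x\<in>phase_space. kepler_family \<kappa> a x = kepler_family \<kappa> c x"
    and "poisson_on phase_space (kepler_family \<kappa> c)"
  proof (elim disjE exE)
    fix \<alpha> \<beta> assume "\<forall>x\<in>phase_space. kepler_family \<kappa> a x = kepler_P1 \<kappa> \<alpha> \<beta> x"
    then show thesis unfolding kepler_P1_eq_family
      by (rule that) (rule poisson_kepler_familyI, simp add: params_defs algebra_simps)
  next
    fix \<alpha> \<beta> assume "\<forall>x\<in>phase_space. kepler_family \<kappa> a x = kepler_P1_conj \<kappa> \<alpha> \<beta> x"
    then show thesis unfolding kepler_P1_conj_eq_family
      by (rule that) (rule poisson_kepler_familyI, simp add: params_defs algebra_simps)
  next
    fix \<alpha> assume "\<forall>x\<in>phase_space. kepler_family \<kappa> a x = kepler_P2 \<kappa> \<alpha> x"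
    then show thesis unfolding kepler_P2_eq_family
      by (rule that) (rule poisson_kepler_familyI, simp add: params_defs)
  next
    fix \<alpha> \<beta> \<gamma> \<delta> assume "\<forall>x\<in>phase_space. kepler_family \<kappa> a x = kepler_P3 \<kappa> \<alpha> \<beta> x + kepler_P4 \<kappa> \<gamma> \<delta> x"
    then show thesis unfolding kepler_P3_plus_P4_eq_family
      by (rule that) (rule poisson_kepler_familyI, simp add: params_defs)
  qed
  then show ?L using poisson_on_cong[OF open_phase_space] by metis
qed

lemma poisson_kepler_Ps:
  "poisson_on phase_space (kepler_P1 \<kappa> a b)" "poisson_on phase_space (kepler_P2 \<kappa> a)"
  "poisson_on phase_space (kepler_P3 \<kappa> a b)" "poisson_on phase_space (kepler_P4 \<kappa> a b)"
  unfolding kepler_P1_eq_family kepler_P2_eq_family kepler_P3_eq_family kepler_P4_eq_family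
  by (rule poisson_kepler_familyI, simp add: params_defs algebra_simps)+

section \<open>Contraction with the differential of the angular momentum\<close>

lemma bivector_apply_K3:
  "bivector_apply B kepler_K3 x = B x *v vector [coord x 4, - coord x 3,
     - coord x 2, coord x 1]"
proof -
  have "differential kepler_K3 x = vector [coord x 4, - coord x 3,
     - coord x 2, coord x 1]"
    by (simp add: vec_eq_iff differential_def has_pds_imp_pd[OF has_pds_kepler_K3])
  then show ?thesis by (simp add: bivector_apply_def)
qed

text \<open>X3 annihilates K3, while X1 K3 = K2 and X2 K3 = - K1. Contracting the wedge product with
  dK3 therefore leaves a multiple of X3 = P dK3.\<close>

lemma kepler_P1_K3:
  assumes "x \<in> phase_space"
  shows "bivector_apply (kepler_P1 \<kappa> a b) kepler_K3 x - (b - a * (\<i> * kepler_K1 \<kappa> x - kepler_K2 \<kappa> x))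
            *s bivector_apply canonical_P kepler_K3 x = 0"
  unfolding kepler_P1_eq_family
  unfolding bivector_apply_K3 kepler_family_eq[OF assms] radial_relations[OF assms] canonical_P_def
  unfolding kepler_K1_eq kepler_K2_eq kepler_K3_eq radial_relations[OF assms] fam_matrix_def fam_scalar_def
      Let_def
  by (simp add: vec_eq_iff forall_4 matrix_vector_mult_def sum_4 skew_matrix_nth vector_4_nth params_defs
      poly_expand)

lemma kepler_P2_K3:
  assumes "x \<in> phase_space"
  shows "bivector_apply (kepler_P2 \<kappa> a) kepler_K3 x
          - a *s (kepler_K3 x *s bivector_apply canonical_P (kepler_H \<kappa>) x
                  + (3 * kepler_H \<kappa> x) *s bivector_apply canonical_P kepler_K3 x) = 0"
  unfolding kepler_P2_eq_family
  unfolding bivector_apply_K3 canonical_apply[OF has_pds_kepler_H[OF assms]] kepler_family_eq[OF assms]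
      radial_relations[OF assms] canonical_P_def
  unfolding kepler_H_eq kepler_K3_eq radial_relations[OF assms] fam_matrix_def fam_scalar_def Let_def
  by (simp add: vec_eq_iff forall_4 matrix_vector_mult_def sum_4 skew_matrix_nth vector_4_nth params_defs
      poly_expand)

text \<open>The terms - K2 P and K1 P cancel the contractions of X1 wedge X3 and X2 wedge X3 with
  dK3. Only the common summand, with coefficient \<open>b\<close>, contributes.\<close>

lemma kepler_P34_K3:
  assumes "x \<in> phase_space"
  shows "2 *s bivector_apply (kepler_family \<kappa> (P34_params a c b)) kepler_K3 x
          + (b * kepler_K3 x) *s bivector_apply canonical_P (kepler_H \<kappa>) x = 0"
  unfolding bivector_apply_K3 canonical_apply[OF has_pds_kepler_H[OF assms]] kepler_family_eq[OF assms]
      radial_relations[OF assms] canonical_P_def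
  unfolding kepler_K3_eq radial_relations[OF assms] fam_matrix_def fam_scalar_def Let_def
  by (simp add: vec_eq_iff forall_4 matrix_vector_mult_def sum_4 skew_matrix_nth vector_4_nth params_defs
      poly_expand)

section \<open>Compatibility with the canonical bivector\<close>

lemma canonical_jacobiator_123:
  "jacobiator (canonical_P x) (fam_pd a q1 q2 p1 p2 v) 1 2 3 =
     2 * q1 * (q1 * p2 - q2 * p1) * a 4 - q1 * p1 * a 5 + (q2 * p1 - 2 * q1 * p2) * a 6 + q1 * a 7
         + p2 * (a 3 - a 9 / 2)"
  unfolding jacobiator_def canonical_P_def fam_expand by (simp add: poly_expand)

text \<open>Hamiltonian fields preserve P, so the bracket of P with their wedge products vanishes;
  the expansion confirms this.\<close>

lemma canonical_jacobiator_P1: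
  "jacobiator (canonical_P x) (fam_pd (P1_params a b) q1 q2 p1 p2 v) i j k = 0"
  by (rule jacobiator_eq_0[OF transpose_fam_pd];
      unfold jacobiator_def canonical_P_def fam_expand P1_params_def; simp add: poly_expand)

lemma schouten_canonical_family:
  assumes x: "x \<in> phase_space"
  shows "schouten canonical_P (kepler_family \<kappa> a) i j k x = - jacobiator (canonical_P x) (fam_pd a
    (coord x 1) (coord x 2) (coord x 3) (coord x 4)
    (radial \<kappa> 5 x)) i j k"
  by (rule schouten_canonical[OF has_pds_kepler_family[OF x]])

lemma compatible_P1: "compatible_on phase_space canonical_P (kepler_P1 \<kappa> a b)"
  by (simp add: compatible_on_def kepler_P1_eq_family schouten_canonical_family canonical_jacobiator_P1)

text \<open>One bracket component at one point gives a linear condition on the parameters, which is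
  enough to refute compatibility for P2, P3 and P4.\<close>

lemma compatible_familyD:
  assumes "compatible_on phase_space canonical_P (kepler_family \<kappa> a)" "(q1, q2) \<noteq> (0, 0)"
  shows "2 * of_real q1 * (of_real q1 * of_real p2 - of_real q2 * of_real p1) * a 4
      - of_real q1 * of_real p1 * a 5
    + (of_real q2 * of_real p1 - 2 * of_real q1 * of_real p2) * a 6 + of_real q1 * a 7
        + of_real p2 * (a 3 - a 9 / 2) = 0"
proof -
  let ?x = "vector [q1, q2, p1, p2] :: point"
  have x: "?x \<in> phase_space" using assms(2) by (simp add: phase_space_def vector_4_nth)
  then have "schouten canonical_P (kepler_family \<kappa> a) 1 2 3 ?x = 0" using assms(1)
      by (simp add: compatible_on_def)
  then show ?thesis
    unfolding schouten_canonical_family[OF x] canonical_jacobiator_123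
    by (simp only: neg_equal_0_iff_equal vector_4_nth)
qed

lemma not_compatible_P2:
  "a \<noteq> 0 \<Longrightarrow> \<not> compatible_on phase_space canonical_P (kepler_P2 \<kappa> a)"
  using compatible_familyD[of \<kappa> "P2_params a" 0 1 1 0] by (auto simp: kepler_P2_eq_family params_defs)

lemma not_compatible_P34:
  assumes "(a, b, c) \<noteq> (0, 0, 0)"
  shows "\<not> compatible_on phase_space canonical_P (kepler_family \<kappa> (P34_params a b c))"
proof
  assume h: "compatible_on phase_space canonical_P (kepler_family \<kappa> (P34_params a b c))"
  show False
    \<comment> \<open>Unit positions and momenta along the axes isolate \<open>a\<close>,
      \<open>b\<close> and \<open>c\<close>.\<close>
    using compatible_familyD[OF h, of 0 1 0 1] compatible_familyD[OF h, of 0 1 1 0] compatible_familyD[OF h,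
        of 1 0 0 1] compatible_familyD[OF h, of 1 0 1 0] assms
    by (auto simp: params_defs)
qed

subsection \<open>Ranks\<close>

text \<open>Along a line through \<open>x\<close> the function is a nonzero polynomial, so its zeros
  are finite in number and cannot fill a neighbourhood of \<open>x\<close> on the line.\<close>

lemma closure_nonzero_along_line:
  fixes f :: "point \<Rightarrow> complex" and p :: "complex poly"
  assumes x: "x \<in> phase_space" and p: "p \<noteq> 0"
      and f: "\<And>t::real. f (x + t *\<^sub>R v) = poly p (complex_of_real t)"
  shows "x \<in> closure {y \<in> phase_space. f y \<noteq> 0}"
  unfolding closure_approachable
proof (intro allI impI)
  fix e :: real assume "e > 0"
  obtain d where d: "d > 0" "ball x d \<subseteq> phase_space"
    using open_phase_space x by (auto simp: open_contains_ball)
  \<comment> \<open>The added 1 keeps the quotient defined even for v = 0.\<close>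
  define \<delta> where "\<delta> = min d e / (norm v + 1)"
  have nv: "norm v + 1 > 0" by (simp add: add_nonneg_pos)
  have \<delta>: "\<delta> > 0" using d \<open>e > 0\<close> nv by (simp add: \<delta>_def)
  have "finite {t::real. poly p (complex_of_real t) = 0}"
    using finite_vimageI[OF poly_roots_finite[OF p], of complex_of_real]
        by (simp add: inj_on_def vimage_def)
  moreover have "infinite {0<..<\<delta>}" using \<delta> by simp
  ultimately obtain t where t: "t \<in> {0<..<\<delta>}" "poly p (complex_of_real t) \<noteq> 0"
    by (metis (mono_tags, lifting) finite_subset mem_Collect_eq subsetI)
  have "norm (t *\<^sub>R v) < min d e"
  proof -
    have "norm (t *\<^sub>R v) \<le> t * (norm v + 1)" using t(1) by (simp add: algebra_simps)
    also have "\<dots> < \<delta> * (norm v + 1)" using t(1) nv by simp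
    also have "\<dots> = min d e" using nv by (simp add: \<delta>_def)
    finally show ?thesis .
  qed
  then have "dist (x + t *\<^sub>R v) x < e" "x + t *\<^sub>R v \<in> phase_space"
    using d(2) by (auto simp: dist_norm subset_eq)
  then show "\<exists>y\<in>{y \<in> phase_space. f y \<noteq> 0}. dist y x < e"
    using t(2) f by auto
qed

text \<open>A decomposable bivector has Pfaffian zero, so only b^2 and the cross term with P remain.
  The second factor is the eigenvalue that relates P1 dK3 to P dK3.\<close>

lemma pfaffian_P1:
  assumes "x \<in> phase_space"
  shows "pfaffian (kepler_P1 \<kappa> a b x) = - b * (b - a * (\<i> * kepler_K1 \<kappa> x - kepler_K2 \<kappa> x))"
  unfolding kepler_P1_eq_family kepler_family_eq[OF assms]
  unfolding kepler_K1_eq kepler_K2_eq kepler_K3_eq fam_matrix_def fam_scalar_def Let_def radial_relations[OF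
      assms]
    pfaffian_def skew_matrix_nth
  by (simp add: params_defs poly_expand)

lemma pfaffian_P2:
  assumes "x \<in> phase_space"
  shows "pfaffian (kepler_P2 \<kappa> a x) = - 3 * (a * kepler_H \<kappa> x)\<^sup>2"
  unfolding kepler_P2_eq_family kepler_family_eq[OF assms]
  unfolding kepler_H_eq fam_matrix_def fam_scalar_def Let_def radial_relations[OF assms]
    pfaffian_def skew_matrix_nth
  by (simp add: params_defs poly_expand)

lemma pfaffian_P34:
  assumes "x \<in> phase_space"
  shows "pfaffian (kepler_family \<kappa> (P34_params a b c) x) = 0"
  unfolding kepler_family_eq[OF assms]
  unfolding fam_matrix_def fam_scalar_def Let_def radial_relations[OF assms] pfaffian_def skew_matrix_nth
  by (simp add: params_defs poly_expand)

lemma skew_field_continuous: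
  assumes "skew_field_on U B"
  shows "continuous_on U (\<lambda>y. B y $ i $ j)"
  using assms unfolding skew_field_on_def
  by (meson continuous_at_imp_continuous_on differentiable_imp_continuous_within)

lemma open_nonzero:
  fixes f :: "'a::topological_space \<Rightarrow> 'b::t1_space"
  assumes "open U" "continuous_on U f"
  shows "open {x \<in> U. f x \<noteq> c}"
proof -
  have "{x \<in> U. f x \<noteq> c} = U \<inter> f -` (- {c})" by auto
  then show ?thesis using continuous_open_preimage[OF assms(2,1), of "- {c}"] by (simp add: open_Compl)
qed

lemma nondegenerate_set_pfaffian:
  assumes "skew_field_on U B"
  shows "nondegenerate_set U B = {x \<in> U. pfaffian (B x) \<noteq> 0}"
  using assms invertible_skew_iff_pfaffian by (auto simp: nondegenerate_set_def skew_field_on_def)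

lemma open_nondegenerate_set:
  assumes "skew_field_on U B" "open U"
  shows "open (nondegenerate_set U B)"
  unfolding nondegenerate_set_pfaffian[OF assms(1)] pfaffian_def
  by (intro open_nonzero assms(2) continuous_intros skew_field_continuous[OF assms(1)])

lemma generic_rank_4I:
  assumes "skew_field_on U B" "open U" "U \<subseteq> closure (nondegenerate_set U B)"
  shows "generic_rank_on U B 4"
proof -
  have "{x \<in> U. rank (B x) = 4} = nondegenerate_set U B"
    using rank_eq_card_iff_invertible[of "B _"] by (auto simp: nondegenerate_set_def)
  then show ?thesis
    using assms open_nondegenerate_set by (simp add: generic_rank_on_def)
qed

text \<open>With zero Pfaffian the rank is 0 or 2, so the rank-two locus is where \<open>B\<close>
  is nonzero. This set is open, and it is dense as soon as one entry is nonzero on a dense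
  set.\<close>

lemma generic_rank_2I:
  assumes skew: "skew_field_on U B" and U: "open U" and pf: "\<And>x. x \<in> U \<Longrightarrow> pfaffian (B x) = 0"
    and dense: "U \<subseteq> closure {x \<in> U. B x $ i $ j \<noteq> 0}"
  shows "generic_rank_on U B 2"
proof -
  have zero: "rank (0 :: complex ^ 4 ^ 4) \<noteq> 2"
  proof -
    have "rows (0 :: complex ^ 4 ^ 4) = {0}" by (auto simp: rows_def row_def vec_eq_iff)
    then show ?thesis using vec.dim_le_card'[of "{0 :: complex ^ 4}"] by (simp add: row_rank_def_gen)
  qed
  have "{x \<in> U. rank (B x) = 2} = {x \<in> U. B x \<noteq> 0}"
    using rank_skew_eq_2 zero pf skew by (auto simp: skew_field_on_def)
  also have "\<dots> = (\<Union>k l. {x \<in> U. B x $ k $ l \<noteq> 0})" by (auto simp: vec_eq_iff)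
  finally have eq: "{x \<in> U. rank (B x) = 2} = (\<Union>k l. {x \<in> U. B x $ k $ l \<noteq> 0})" .
  have "open {x \<in> U. rank (B x) = 2}"
    unfolding eq by (intro open_UN ballI open_nonzero U skew_field_continuous[OF skew])
  moreover have "{x \<in> U. B x $ i $ j \<noteq> 0} \<subseteq> {x \<in> U. rank (B x) = 2}" unfolding eq by blast
  ultimately show ?thesis
    using dense closure_mono unfolding generic_rank_on_def by blast
qed

lemma skew_kepler_P1: "skew_field_on phase_space (kepler_P1 \<kappa> a b)"
  unfolding kepler_P1_eq_family by (rule skew_kepler_family)

lemma skew_kepler_P2: "skew_field_on phase_space (kepler_P2 \<kappa> a)"
  unfolding kepler_P2_eq_family by (rule skew_kepler_family)

text \<open>Along lines in momentum space the radius is constant, so the first integrals restrict to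
  polynomials.\<close>

lemma radial_fiber:
  "y $ 1 = x $ 1 \<Longrightarrow> y $ 2 = x $ 2 \<Longrightarrow> radial \<kappa> n y = radial \<kappa> n x"
  by (simp add: radial_def)

lemma dense_nondegenerate_P1:
  assumes "b \<noteq> 0"
  shows "phase_space \<subseteq> closure (nondegenerate_set phase_space (kepler_P1 \<kappa> a b))"
proof
  fix x assume x: "x \<in> phase_space"
  define f where "f = (\<lambda>y. b - a * (\<i> * kepler_K1 \<kappa> y - kepler_K2 \<kappa> y))"
  have nd: "nondegenerate_set phase_space (kepler_P1 \<kappa> a b) = {y \<in> phase_space. f y \<noteq> 0}"
    unfolding nondegenerate_set_pfaffian[OF skew_kepler_P1] using assms by (auto simp: pfaffian_P1 f_def)
  \<comment> \<open>Moving the momentum orthogonally to the position changes K3 linearly. The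
    quadratic coefficient of \<open>f\<close> is then - a (q1^2 + q2^2)(q1 + i q2), nonzero for real
    q other than 0 unless a = 0.\<close>
  define v :: point where "v = vector [0, 0, x $ 2, - x $ 1]"
  define q1 where "q1 = coord x 1"
  define q2 where "q2 = coord x 2"
  define p1 where "p1 = coord x 3"
  define p2 where "p2 = coord x 4"
  define L where "L = q1 * p2 - q2 * p1"
  define c2 where "c2 = - a * (q1\<^sup>2 + q2\<^sup>2) * (q1 + \<i> * q2)"
  define c1 where "c1 = a * (\<i> * (q2 * L - p1 * (q1\<^sup>2 + q2\<^sup>2)) + (q1 * L + p2 * (q1\<^sup>2 + q2\<^sup>2)))"
  have rad: "radial \<kappa> 1 (x + t *\<^sub>R v) = radial \<kappa> 1 x" for t
    by (rule radial_fiber) (simp_all add: v_def vector_4_nth)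
  have "f (x + t *\<^sub>R v) = poly [: f x, c1, c2 :] (complex_of_real t)" for t
    unfolding f_def kepler_K1_eq kepler_K2_eq kepler_K3_eq rad c1_def c2_def L_def q1_def q2_def p1_def
        p2_def
    by (simp add: v_def vector_4_nth poly_expand)
  moreover have "[: f x, c1, c2 :] \<noteq> 0"
  proof (cases "a = 0")
    case True then show ?thesis using assms by (simp add: f_def)
  next
    case False
    have "q1\<^sup>2 + q2\<^sup>2 \<noteq> 0"
    proof -
      have "q1\<^sup>2 + q2\<^sup>2 = complex_of_real ((x $ 1)\<^sup>2 + (x $ 2)\<^sup>2)" by (simp add: q1_def q2_def)
      then show ?thesis using phase_space_radius[OF x] by (simp only: of_real_eq_0_iff)
    qed
    moreover have "q1 + \<i> * q2 \<noteq> 0"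
      using x by (auto simp: q1_def q2_def complex_eq_iff phase_space_def)
    ultimately show ?thesis using False by (simp add: c2_def)
  qed
  ultimately have "x \<in> closure {y \<in> phase_space. f y \<noteq> 0}"
    by (rule closure_nonzero_along_line[OF x, rotated])
  then show "x \<in> closure (nondegenerate_set phase_space (kepler_P1 \<kappa> a b))" using nd by simp
qed

lemma dense_nondegenerate_P2:
  assumes "a \<noteq> 0"
  shows "phase_space \<subseteq> closure (nondegenerate_set phase_space (kepler_P2 \<kappa> a))"
proof
  fix x assume x: "x \<in> phase_space"
  have nd: "nondegenerate_set phase_space (kepler_P2 \<kappa> a) = {y \<in> phase_space. kepler_H \<kappa> y \<noteq> 0}"
    unfolding nondegenerate_set_pfaffian[OF skew_kepler_P2] using assms by (auto simp: pfaffian_P2)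
  define v :: point where "v = vector [0, 0, 1, 0]"
  have rad: "radial \<kappa> 1 (x + t *\<^sub>R v) = radial \<kappa> 1 x" for t
    by (rule radial_fiber) (simp_all add: v_def vector_4_nth)
  have "kepler_H \<kappa> (x + t *\<^sub>R v) = poly [: kepler_H \<kappa> x, coord x 3, 1 / 2 :] (complex_of_real t)" for t
    unfolding kepler_H_eq rad by (simp add: v_def vector_4_nth poly_expand)
  then have "x \<in> closure {y \<in> phase_space. kepler_H \<kappa> y \<noteq> 0}"
    by (rule closure_nonzero_along_line[OF x, rotated]) simp
  then show "x \<in> closure (nondegenerate_set phase_space (kepler_P2 \<kappa> a))" using nd by simp
qed

lemma entry12_P34:
  "x \<in> phase_space \<Longrightarrow> kepler_family \<kappa> (P34_params a b c) x $ 1 $ 2 =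
    (a * coord x 1 + b * coord x 2 + c)
      * (coord x 1 * coord x 4 - coord x 2 * coord x 3)"
  by (simp add: kepler_family_eq fam_matrix_def Let_def skew_matrix_nth params_defs)

text \<open>The entry (1,2) is K3 times an affine function of position, so it suffices to find a
  line on which both factors are nonzero polynomials.\<close>

lemma generic_rank_P34:
  assumes "(a, b, c) \<noteq> (0, 0, 0)"
  shows "generic_rank_on phase_space (kepler_family \<kappa> (P34_params a b c)) 2"
proof (rule generic_rank_2I[OF skew_kepler_family open_phase_space pfaffian_P34])
  define f where "f x = (a * coord x 1 + b * coord x 2 + c)
      * (coord x 1 * coord x 4 - coord x 2 * coord x 3)" for x :: point
  show "phase_space \<subseteq> closure {x \<in> phase_space. kepler_family \<kappa> (P34_params a b c) x $ 1 $ 2 \<noteq> 0}"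
  proof
    fix x assume x: "x \<in> phase_space"
    \<comment> \<open>For nonzero \<open>a\<close> the line moves q1 and p2, otherwise q2 and p1. In
      both cases K3 has leading coefficient 1 or -1; the affine factor has slope \<open>a\<close> or
      \<open>b\<close>, or is the nonzero constant \<open>c\<close>.\<close>
    define s :: real where "s = (if a = 0 then 1 else 0)"
    define v :: point where "v = vector [1 - s, s, s, 1 - s]"
    define p where "p = [: a * coord x 1 + b * coord x 2 + c, a * (1 - of_real s) + b * of_real s :]
      * [: coord x 1 * coord x 4 - coord x 2 * coord x 3,
           (1 - of_real s) * (coord x 1 + coord x 4) - of_real s * (coord x 2 + coord x 3),
           (1 - of_real s)\<^sup>2 - (of_real s)\<^sup>2 :]"
    have "f (x + t *\<^sub>R v) = poly p (complex_of_real t)" for t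
      unfolding f_def p_def by (simp add: v_def vector_4_nth poly_expand)
    moreover have "p \<noteq> 0"
      using assms unfolding p_def s_def by (auto split: if_splits)
    ultimately have "x \<in> closure {x \<in> phase_space. f x \<noteq> 0}"
      by (rule closure_nonzero_along_line[OF x, rotated])
    moreover have "{x \<in> phase_space. f x \<noteq> 0}
        = {x \<in> phase_space. kepler_family \<kappa> (P34_params a b c) x $ 1 $ 2 \<noteq> 0}"
      using entry12_P34 by (auto simp: f_def)
    ultimately show "x \<in> closure {x \<in> phase_space. kepler_family \<kappa> (P34_params a b c) x $ 1 $ 2 \<noteq> 0}"
        by simp
  qed
qed

subsection \<open>Inverse forms\<close>

text \<open>The Pfaffian is a quadratic form; this is its polarisation, hence its derivative at
  \<open>A\<close> along \<open>B\<close>.\<close>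

definition pf_polar :: "complex ^ 4 ^ 4 \<Rightarrow> complex ^ 4 ^ 4 \<Rightarrow> complex" where
  "pf_polar A B = A $ 1 $ 2 * B $ 3 $ 4
      + A $ 3 $ 4 * B $ 1 $ 2 - A $ 1 $ 3 * B $ 2 $ 4 - A $ 2 $ 4 * B $ 1 $ 3
     + A $ 1 $ 4 * B $ 2 $ 3 + A $ 2 $ 3 * B $ 1 $ 4"

text \<open>The quotient rule for \<open>pf_dual b\<close> over \<open>pfaffian b\<close> in the
  direction \<open>d\<close>. This rational form allows denominators to be cleared and entries to be
  compared when proving closedness.\<close>

definition inverse_pd :: "complex ^ 4 ^ 4 \<Rightarrow> complex ^ 4 ^ 4 \<Rightarrow> complex ^ 4 ^ 4" where
  "inverse_pd b d = (\<chi> i j. inverse (pfaffian b) * pf_dual d $ i $ j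
      - pf_polar b d / (pfaffian b)\<^sup>2 * pf_dual b $ i $ j)"

lemma inverse_pd_nth:
  assumes "pfaffian b \<noteq> 0"
  shows "(pfaffian b)\<^sup>2 * inverse_pd b d $ i $ j
      = pfaffian b * pf_dual d $ i $ j - pf_polar b d * pf_dual b $ i $ j"
  using assms by (simp add: inverse_pd_def field_simps power2_eq_square)

lemma transpose_pf_dual: "transpose (pf_dual A) = - pf_dual A"
  by (simp add: pf_dual_def transpose_skew_matrix)

lemma transpose_inverse_pd: "transpose (inverse_pd b d) = - inverse_pd b d"
proof -
  have "inverse_pd b d $ j $ i = - inverse_pd b d $ i $ j" for i j
    unfolding inverse_pd_def vec_lambda_beta
      skew_entries(2)[OF transpose_pf_dual, of b i j] skew_entries(2)[OF transpose_pf_dual, of d i j]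
    by simp
  then show ?thesis by (rule skewI)
qed

lemma has_pds_pfaffian:
  assumes "\<And>i j. has_pds (\<lambda>y. B y $ i $ j) (\<lambda>m. D m $ i $ j) x"
  shows "has_pds (\<lambda>y. pfaffian (B y)) (\<lambda>m. pf_polar (B x) (D m)) x"
  unfolding pfaffian_def
  by (rule has_pds_eq_rhs, (rule has_pds_intros assms)+) (simp add: pf_polar_def algebra_simps)

lemma has_pds_pf_dual:
  assumes "\<And>i j. has_pds (\<lambda>y. B y $ i $ j) (\<lambda>m. D m $ i $ j) x"
  shows "has_pds (\<lambda>y. pf_dual (B y) $ i $ j) (\<lambda>m. pf_dual (D m) $ i $ j) x"
proof -
  have "\<forall>i j. has_pds (\<lambda>y. pf_dual (B y) $ i $ j) (\<lambda>m. pf_dual (D m) $ i $ j) x"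
    unfolding forall_4 pf_dual_def skew_matrix_nth
    by (intro conjI has_pds_minus assms; simp add: has_pds_const assms)
  then show ?thesis by blast
qed

lemma has_pds_inverse_form:
  assumes "open N" "x \<in> N"
    and N: "\<And>y. y \<in> N \<Longrightarrow> transpose (B y) = - B y \<and> pfaffian (B y) \<noteq> 0"
    and pds: "\<And>i j. has_pds (\<lambda>y. B y $ i $ j) (\<lambda>m. D m $ i $ j) x"
  shows "has_pds (\<lambda>y. inverse_form B y $ i $ j) (\<lambda>m. inverse_pd (B x) (D m) $ i $ j) x"
proof (rule has_pds_transform_open[OF _ assms(1,2)])
  show "has_pds (\<lambda>y. inverse (pfaffian (B y)) * pf_dual (B y) $ i $ j) (\<lambda>m. inverse_pd (B x)
      (D m) $ i $ j) x"
    using N[OF assms(2)]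
    by (intro has_pds_eq_rhs[OF has_pds_mult[OF has_pds_inverse[OF has_pds_pfaffian[OF pds]]
        has_pds_pf_dual[OF pds]]])
       (simp_all add: inverse_pd_def)
  show "inverse (pfaffian (B y)) * pf_dual (B y) $ i $ j = inverse_form B y $ i $ j" if "y \<in> N" for y
    using N[OF that] by (simp add: inverse_form_def matrix_inv_skew cscale_def)
qed

text \<open>The coefficients are the complementary minors of the inverse matrix.\<close>

lemma inverse_pd_cyclic:
  assumes b: "transpose b = - b" and D: "\<And>m. transpose (D m) = - D m" and pf: "pfaffian b \<noteq> 0"
  shows "(pfaffian b)\<^sup>2 * (inverse_pd b (D 2) $ 3 $ 4 + inverse_pd b (D 3) $ 4 $ 2
      + inverse_pd b (D 4) $ 2 $ 3)
      = - b $ 1 $ 2 * jacobiator b D 1 3 4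
          + b $ 1 $ 3 * jacobiator b D 1 2 4 - b $ 1 $ 4 * jacobiator b D 1 2 3"
    and "(pfaffian b)\<^sup>2 * (inverse_pd b (D 1) $ 3 $ 4 + inverse_pd b (D 3) $ 4 $ 1
        + inverse_pd b (D 4) $ 1 $ 3)
      = b $ 1 $ 2 * jacobiator b D 2 3 4 - b $ 2 $ 3 * jacobiator b D 1 2 4
          + b $ 2 $ 4 * jacobiator b D 1 2 3"
    and "(pfaffian b)\<^sup>2 * (inverse_pd b (D 1) $ 2 $ 4 + inverse_pd b (D 2) $ 4 $ 1
        + inverse_pd b (D 4) $ 1 $ 2)
      = - b $ 1 $ 3 * jacobiator b D 2 3 4
          + b $ 2 $ 3 * jacobiator b D 1 3 4 - b $ 3 $ 4 * jacobiator b D 1 2 3"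
    and "(pfaffian b)\<^sup>2 * (inverse_pd b (D 1) $ 2 $ 3 + inverse_pd b (D 2) $ 3 $ 1
        + inverse_pd b (D 3) $ 1 $ 2)
      = b $ 1 $ 4 * jacobiator b D 2 3 4 - b $ 2 $ 4 * jacobiator b D 1 3 4
          + b $ 3 $ 4 * jacobiator b D 1 2 4"
proof -
  note sk = skew_entries[OF b]
  note skD = skew_entries[OF D]
  note ev = sk(1) sk(2)[of 2 1] sk(2)[of 3 1] sk(2)[of 4 1] sk(2)[of 3 2] sk(2)[of 4 2] sk(2)[of 4 3]
    skD(1) skD(2)[of _ 2 1] skD(2)[of _ 3 1] skD(2)[of _ 4 1] skD(2)[of _ 3 2] skD(2)[of _ 4 2] skD(2)[of _
        4 3]
  note ex = distrib_left[of "(pfaffian b)\<^sup>2"] inverse_pd_nth[OF pf] jacobiator_def sum_4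
  show "(pfaffian b)\<^sup>2 * (inverse_pd b (D 2) $ 3 $ 4 + inverse_pd b (D 3) $ 4 $ 2
      + inverse_pd b (D 4) $ 2 $ 3)
      = - b $ 1 $ 2 * jacobiator b D 1 3 4
          + b $ 1 $ 3 * jacobiator b D 1 2 4 - b $ 1 $ 4 * jacobiator b D 1 2 3"
    unfolding ex unfolding pf_dual_def skew_matrix_nth ev pfaffian_def pf_polar_def
        by (simp add: algebra_simps)
  show "(pfaffian b)\<^sup>2 * (inverse_pd b (D 1) $ 3 $ 4 + inverse_pd b (D 3) $ 4 $ 1
      + inverse_pd b (D 4) $ 1 $ 3)
      = b $ 1 $ 2 * jacobiator b D 2 3 4 - b $ 2 $ 3 * jacobiator b D 1 2 4
          + b $ 2 $ 4 * jacobiator b D 1 2 3"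
    unfolding ex unfolding pf_dual_def skew_matrix_nth ev pfaffian_def pf_polar_def
        by (simp add: algebra_simps)
  show "(pfaffian b)\<^sup>2 * (inverse_pd b (D 1) $ 2 $ 4 + inverse_pd b (D 2) $ 4 $ 1
      + inverse_pd b (D 4) $ 1 $ 2)
      = - b $ 1 $ 3 * jacobiator b D 2 3 4
          + b $ 2 $ 3 * jacobiator b D 1 3 4 - b $ 3 $ 4 * jacobiator b D 1 2 3"
    unfolding ex unfolding pf_dual_def skew_matrix_nth ev pfaffian_def pf_polar_def
        by (simp add: algebra_simps)
  show "(pfaffian b)\<^sup>2 * (inverse_pd b (D 1) $ 2 $ 3 + inverse_pd b (D 2) $ 3 $ 1
      + inverse_pd b (D 3) $ 1 $ 2)
      = b $ 1 $ 4 * jacobiator b D 2 3 4 - b $ 2 $ 4 * jacobiator b D 1 3 4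
          + b $ 3 $ 4 * jacobiator b D 1 2 4"
    unfolding ex unfolding pf_dual_def skew_matrix_nth ev pfaffian_def pf_polar_def
        by (simp add: algebra_simps)
qed

lemma inverse_pd_closed:
  assumes b: "transpose b = - b" and D: "\<And>m. transpose (D m) = - D m" and pf: "pfaffian b \<noteq> 0"
    and J: "\<And>i j k. jacobiator b D i j k = 0"
  shows "inverse_pd b (D i) $ j $ k + inverse_pd b (D j) $ k $ i + inverse_pd b (D k) $ i $ j = 0"
proof (rule alternating_eq_0[of "\<lambda>i j k. inverse_pd b (D i) $ j $ k + inverse_pd b (D j) $ k $ i
    + inverse_pd b (D k) $ i $ j"])
  have s: "inverse_pd b d $ j $ i = - inverse_pd b d $ i $ j" for d i j
    by (rule skew_entries(2)[OF transpose_inverse_pd])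
  fix i j k
  show "inverse_pd b (D j) $ k $ i + inverse_pd b (D k) $ i $ j + inverse_pd b (D i) $ j $ k
      = inverse_pd b (D i) $ j $ k + inverse_pd b (D j) $ k $ i + inverse_pd b (D k) $ i $ j" by simp
  show "inverse_pd b (D j) $ i $ k + inverse_pd b (D i) $ k $ j + inverse_pd b (D k) $ j $ i
      = - (inverse_pd b (D i) $ j $ k + inverse_pd b (D j) $ k $ i + inverse_pd b (D k) $ i $ j)"
    using s[where d="D j" and i=i and j=k] s[where d="D i" and i=k and j=j] s[where d="D k" and i=j and j=i]
    by simp
qed (use inverse_pd_cyclic[where D = D, OF b D pf] pf J in \<open>simp_all\<close>)

text \<open>The derivative of \<open>b ** pf_dual b = mat (pfaffian b)\<close> along
  \<open>d\<close>, multiplied on the left by \<open>pf_dual b\<close>. It reconciles the quotient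
  rule with the matrix formula for the derivative of an inverse.\<close>

lemma pf_dual_polarization:
  assumes "transpose b = - b" "transpose d = - d"
  shows "pf_dual b ** d ** pf_dual b
      = (\<chi> i j. pf_polar b d * pf_dual b $ i $ j - pfaffian b * pf_dual d $ i $ j)"
proof -
  have "pf_dual (skew_matrix b12 b13 b14 b23 b24 b34) ** skew_matrix d12 d13 d14 d23 d24 d34 ** pf_dual
      (skew_matrix b12 b13 b14 b23 b24 b34)
     = (\<chi> i j. pf_polar (skew_matrix b12 b13 b14 b23 b24 b34) (skew_matrix d12 d13 d14 d23 d24 d34)
          * pf_dual (skew_matrix b12 b13 b14 b23 b24 b34) $ i $ j
        - pfaffian (skew_matrix b12 b13 b14 b23 b24 b34) * pf_dual
            (skew_matrix d12 d13 d14 d23 d24 d34) $ i $ j)"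
    for b12 b13 b14 b23 b24 b34 d12 d13 d14 d23 d24 d34
    by (simp add: vec_eq_iff forall_4 pf_dual_def pfaffian_def pf_polar_def skew_matrix_nth
        matrix_matrix_mult_def sum_4 algebra_simps)
  from this[of "b $ 1 $ 2" "b $ 1 $ 3" "b $ 1 $ 4" "b $ 2 $ 3" "b $ 2 $ 4" "b $ 3 $ 4"
     "d $ 1 $ 2" "d $ 1 $ 3" "d $ 1 $ 4" "d $ 2 $ 3" "d $ 2 $ 4" "d $ 3 $ 4"]
  show ?thesis by (simp only: skew_eq_skew_matrix[OF assms(1), symmetric] skew_eq_skew_matrix[OF assms(2),
      symmetric])
qed

lemma inverse_pd_eq:
  assumes "transpose b = - b" "transpose d = - d" "pfaffian b \<noteq> 0"
  shows "inverse_pd b d = - (matrix_inv b ** d ** matrix_inv b)"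
proof -
  have "(matrix_inv b ** d ** matrix_inv b) $ i $ j
      = inverse ((pfaffian b)\<^sup>2) * (pf_dual b ** d ** pf_dual b) $ i $ j" for i j
    unfolding matrix_inv_skew[OF assms(1,3)]
    by (simp add: matrix_matrix_mult_def cscale_def sum_4 algebra_simps power2_eq_square)
  then show ?thesis
    using assms(3) unfolding pf_dual_polarization[OF assms(1,2)]
    by (simp add: vec_eq_iff inverse_pd_def field_simps power2_eq_square)
qed

lemma matrix_mult_add_rdistrib:
  fixes A B :: "'a::semiring_1 ^ 'n ^ 'm"
  shows "(A + B) ** C = A ** C + B ** C"
  by (simp add: vec_eq_iff matrix_matrix_mult_def sum.distrib distrib_right)

text \<open>With \<open>A\<close> the Jacobian matrix of the field, invariance of \<open>b\<close>
  reads \<open>XD = A ** b + b ** transpose A\<close>. Multiplication by the inverse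
  \<open>W\<close> on both sides cancels \<open>b\<close> and gives invariance of
  \<open>W\<close>.\<close>

lemma inverse_pd_lie:
  assumes b: "transpose b = - b" and D: "\<And>m. transpose (D m) = - D m" and pf: "pfaffian b \<noteq> 0"
    and L: "\<And>i j. lie_jet X dX b D i j = 0"
  shows "(\<Sum>m\<in>UNIV. X $ m * inverse_pd b (D m) $ i $ j + matrix_inv b $ m $ j * dX i $ m
      + matrix_inv b $ i $ m * dX j $ m) = 0"
proof -
  define W where "W = matrix_inv b"
  define A where "A = (\<chi> i m. dX m $ i)"
  define XD where "XD = (\<chi> i j. \<Sum>m\<in>UNIV. X $ m * D m $ i $ j)"
  have inv: "W ** b = mat 1" "b ** W = mat 1" using matrix_inv_skew_mult[OF b pf] by (simp_all add: W_def)
  have XD: "XD = A ** b + b ** transpose A"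
    using L by (simp add: vec_eq_iff XD_def A_def transpose_def lie_jet_def matrix_matrix_mult_def sum_4
        algebra_simps)
  have "(\<Sum>m\<in>UNIV. X $ m * inverse_pd b (D m) $ i $ j) = - (W ** XD ** W) $ i $ j"
    unfolding inverse_pd_eq[OF b D pf] W_def[symmetric]
    by (simp add: XD_def matrix_matrix_mult_def sum_4 algebra_simps)
  also have "W ** XD ** W = W ** A ** (b ** W) + (W ** b) ** transpose A ** W"
    unfolding XD by (simp add: matrix_add_ldistrib matrix_mult_add_rdistrib matrix_mul_assoc)
  also have "\<dots> = W ** A + transpose A ** W" unfolding inv by simp
  finally show ?thesis
    by (simp add: W_def A_def transpose_def matrix_matrix_mult_def sum_4 algebra_simps)
qed

text \<open>Makes P a member of the family, so that its symplectic form falls under the same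
  argument as the others.\<close>

lemma canonical_eq_P1: "canonical_P = kepler_P1 \<kappa> 0 1"
  by (simp add: fun_eq_iff vec_eq_iff kepler_P1_def cscale_def)

lemma nondegenerate_canonical: "nondegenerate_set phase_space canonical_P = phase_space"
proof -
  have "skew_field_on phase_space canonical_P"
    using skew_kepler_P1[of 0 0 1] by (simp add: canonical_eq_P1[symmetric])
  then show ?thesis
    by (simp add: nondegenerate_set_pfaffian pfaffian_def canonical_P_def skew_matrix_nth)
qed

text \<open>Off \<open>N\<close> the value of \<open>matrix_inv\<close> is an unspecified choice. On
  the open set \<open>N\<close> the Pfaffian formula for the inverse holds near every point and can
  be differentiated.\<close>

lemma inverse_form_kepler_family:
  assumes poisson: "poisson_on phase_space (kepler_family \<kappa> a)"
  defines "B \<equiv> kepler_family \<kappa> a"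
  defines "N \<equiv> nondegenerate_set phase_space B"
  shows "symplectic_on N (inverse_form B)" "invariant_form_on N (kepler_X \<kappa>) (inverse_form B)"
proof -
  define D where "D x = fam_pd a (coord x 1) (coord x 2)
    (coord x 3) (coord x 4) (radial \<kappa> 5 x)" for x :: point
  have skew: "skew_field_on phase_space B" unfolding B_def by (rule skew_kepler_family)
  have openN: "open N" unfolding N_def by (rule open_nondegenerate_set[OF skew open_phase_space])
  have N: "x \<in> phase_space \<and> transpose (B x) = - B x \<and> pfaffian (B x) \<noteq> 0" if "x \<in> N" for x
    using that skew unfolding N_def nondegenerate_set_pfaffian[OF skew] by (simp add: skew_field_on_def)
  have pds: "has_pds (\<lambda>y. B y $ i $ j) (\<lambda>m. D x m $ i $ j) x" if "x \<in> N" for x i j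
    unfolding B_def D_def using N[OF that] by (intro has_pds_kepler_family) simp
  have D: "transpose (D x m) = - D x m" for x m unfolding D_def by (rule transpose_fam_pd)
  have pdsI: "has_pds (\<lambda>y. inverse_form B y $ i $ j) (\<lambda>m. inverse_pd (B x) (D x m) $ i $ j) x"
      if "x \<in> N" for x i j
    by (rule has_pds_inverse_form[OF openN that _ pds[OF that]]) (use N in blast)
  have J: "jacobiator (B x) (D x) i j k = 0" if "x \<in> N" for x i j k
    using poisson N[OF that] schouten_self[of B, OF pds[OF that], of i j k]
        by (simp add: poisson_on_def B_def)
  have inv: "inverse_form B x = inverse (pfaffian (B x)) *\<^sub>m pf_dual (B x)" if "x \<in> N" for x
    using N[OF that] by (simp add: inverse_form_def matrix_inv_skew)
  show "symplectic_on N (inverse_form B)"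
    unfolding symplectic_on_def skew_field_on_def
  proof (intro conjI ballI allI)
    fix x i j k assume x: "x \<in> N"
    have "(inverse (pfaffian (B x)) *\<^sub>m pf_dual (B x)) $ j $ i
        = - (inverse (pfaffian (B x)) *\<^sub>m pf_dual (B x)) $ i $ j" for i j
      unfolding cscale_def vec_lambda_beta skew_entries(2)[OF transpose_pf_dual, of "B x" i j] by simp
    then show "transpose (inverse_form B x) = - inverse_form B x"
      unfolding inv[OF x] by (rule skewI)
    show "(\<lambda>y. inverse_form B y $ i $ j) differentiable at x"
      by (rule has_pds_imp_differentiable[OF pdsI[OF x]])
    show "invertible (inverse_form B x)"
      unfolding inverse_form_def invertible_def using matrix_inv_skew_mult N[OF x] by blast
    show "ext_deriv_form (inverse_form B) i j k x = 0"
      unfolding ext_deriv_form_def has_pds_imp_pd[OF pdsI[OF x]]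
      using N[OF x] by (intro inverse_pd_closed D J[OF x]) auto
  qed
  show "invariant_form_on N (kepler_X \<kappa>) (inverse_form B)"
    unfolding invariant_form_on_def
  proof
    fix x assume x: "x \<in> N"
    then have ps: "x \<in> phase_space" using N by blast
    define dX where "dX = kepler_X_pd (coord x 1) (coord x 2) (radial \<kappa> 5 x)"
    have pdsX: "has_pds (\<lambda>y. kepler_X \<kappa> y $ i) (\<lambda>m. dX m $ i) x" for i
      unfolding dX_def by (rule has_pds_kepler_X[OF ps])
    have L: "lie_jet (kepler_X \<kappa> x) dX (B x) (D x) i j = 0" for i j
      using invariant_kepler_family[of \<kappa> a] ps
        lie_bivector_eq_lie_jet[of B "D x" x "kepler_X \<kappa>" dX, OF pds[OF x] pdsX, of i j]
      by (simp add: invariant_bivector_on_def B_def)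
    have "lie_form (kepler_X \<kappa>) (inverse_form B) x $ i $ j = 0" for i j
      unfolding lie_form_def vec_lambda_beta has_pds_imp_pd[OF pdsI[OF x]] has_pds_imp_pd[OF pdsX]
      unfolding inverse_form_def
      using N[OF x] by (intro inverse_pd_lie D L) auto
    then show "lie_form (kepler_X \<kappa>) (inverse_form B) x = 0" by (simp add: vec_eq_iff)
  qed
qed

section \<open>Classification of the Poisson members and the invariant symplectic forms\<close>

theorem mainTheorem5:
  fixes \<kappa> :: real
  shows
    "\<comment> \<open>the nine-parameter family solves the invariance equation\<close>
     (\<forall>a. invariant_bivector_on phase_space (kepler_X \<kappa>) (kepler_family \<kappa> a))
   \<and> \<comment> \<open>solution of the Jacobi identity for the parameters\<close>
     (\<forall>a. poisson_on phase_space (kepler_family \<kappa> a) \<longleftrightarrow>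
        (\<exists>\<alpha> \<beta>. \<forall>x\<in>phase_space. kepler_family \<kappa> a x = kepler_P1 \<kappa> \<alpha> \<beta> x) \<or>
        (\<exists>\<alpha> \<beta>. \<forall>x\<in>phase_space. kepler_family \<kappa> a x = kepler_P1_conj \<kappa> \<alpha> \<beta> x) \<or>
        (\<exists>\<alpha>. \<forall>x\<in>phase_space. kepler_family \<kappa> a x = kepler_P2 \<kappa> \<alpha> x) \<or>
        (\<exists>\<alpha> \<beta> \<gamma> \<delta>. \<forall>x\<in>phase_space.
            kepler_family \<kappa> a x = kepler_P3 \<kappa> \<alpha> \<beta> x + kepler_P4 \<kappa> \<gamma> \<delta> x))
   \<and> \<comment> \<open>the four bivectors belong to the family, are invariant and Poisson\<close>
     (\<forall>a b. \<forall>B \<in> {kepler_P1 \<kappa> a b, kepler_P2 \<kappa> a, kepler_P3 \<kappa> a b, kepler_P4 \<kappa> a b}.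
        (\<exists>c. \<forall>x\<in>phase_space. B x = kepler_family \<kappa> c x) \<and>
        invariant_bivector_on phase_space (kepler_X \<kappa>) B \<and> poisson_on phase_space B)
   \<and> \<comment> \<open>ranks\<close>
     (\<forall>a b. b \<noteq> 0 \<longrightarrow> generic_rank_on phase_space (kepler_P1 \<kappa> a b) 4)
   \<and> (\<forall>a. a \<noteq> 0 \<longrightarrow> generic_rank_on phase_space (kepler_P2 \<kappa> a) 4)
   \<and> (\<forall>a b. (a, b) \<noteq> (0, 0) \<longrightarrow> generic_rank_on phase_space (kepler_P3 \<kappa> a b) 2)
   \<and> (\<forall>a b. (a, b) \<noteq> (0, 0) \<longrightarrow> generic_rank_on phase_space (kepler_P4 \<kappa> a b) 2)
   \<and> \<comment> \<open>relations between the Hamiltonian vector fields\<close>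
     (\<forall>a b. \<forall>x\<in>phase_space.
        bivector_apply (kepler_P1 \<kappa> a b) kepler_K3 x
          - (b - a * (\<i> * kepler_K1 \<kappa> x - kepler_K2 \<kappa> x))
            *s bivector_apply canonical_P kepler_K3 x = 0)
   \<and> (\<forall>a. \<forall>x\<in>phase_space.
        bivector_apply (kepler_P2 \<kappa> a) kepler_K3 x
          - a *s (kepler_K3 x *s bivector_apply canonical_P (kepler_H \<kappa>) x
                  + (3 * kepler_H \<kappa> x) *s bivector_apply canonical_P kepler_K3 x) = 0)
   \<and> (\<forall>a b. \<forall>x\<in>phase_space.
        2 *s bivector_apply (kepler_P3 \<kappa> a b) kepler_K3 x
          + (b * kepler_K3 x) *s bivector_apply canonical_P (kepler_H \<kappa>) x = 0)
   \<and> (\<forall>a b. \<forall>x\<in>phase_space.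
        2 *s bivector_apply (kepler_P4 \<kappa> a b) kepler_K3 x
          + (b * kepler_K3 x) *s bivector_apply canonical_P (kepler_H \<kappa>) x = 0)
   \<and> \<comment> \<open>compatibility with the canonical bivector\<close>
     (\<forall>a b. compatible_on phase_space canonical_P (kepler_P1 \<kappa> a b))
   \<and> (\<forall>a. a \<noteq> 0 \<longrightarrow> \<not> compatible_on phase_space canonical_P (kepler_P2 \<kappa> a))
   \<and> (\<forall>a b. (a, b) \<noteq> (0, 0) \<longrightarrow> \<not> compatible_on phase_space canonical_P (kepler_P3 \<kappa> a b))
   \<and> (\<forall>a b. (a, b) \<noteq> (0, 0) \<longrightarrow> \<not> compatible_on phase_space canonical_P (kepler_P4 \<kappa> a b))
   \<and> \<comment> \<open>invariant symplectic forms, on the open dense sets of nondegeneracy\<close>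
     nondegenerate_set phase_space canonical_P = phase_space
   \<and> (\<forall>B. B = canonical_P \<or> (\<exists>a b. b \<noteq> 0 \<and> B = kepler_P1 \<kappa> a b)
            \<or> (\<exists>a. a \<noteq> 0 \<and> B = kepler_P2 \<kappa> a) \<longrightarrow>
        open (nondegenerate_set phase_space B) \<and>
        phase_space \<subseteq> closure (nondegenerate_set phase_space B) \<and>
        symplectic_on (nondegenerate_set phase_space B) (inverse_form B) \<and>
        invariant_form_on (nondegenerate_set phase_space B) (kepler_X \<kappa>) (inverse_form B))"
proof (intro conjI allI impI ballI)
  show "invariant_bivector_on phase_space (kepler_X \<kappa>) (kepler_family \<kappa> a)" for a
    by (rule invariant_kepler_family)
  show "poisson_on phase_space (kepler_family \<kappa> a) \<longleftrightarrow>
        (\<exists>\<alpha> \<beta>. \<forall>x\<in>phase_space. kepler_family \<kappa> a x = kepler_P1 \<kappa> \<alpha> \<beta> x) \<or>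
        (\<exists>\<alpha> \<beta>. \<forall>x\<in>phase_space. kepler_family \<kappa> a x = kepler_P1_conj \<kappa> \<alpha> \<beta> x) \<or>
        (\<exists>\<alpha>. \<forall>x\<in>phase_space. kepler_family \<kappa> a x = kepler_P2 \<kappa> \<alpha> x) \<or>
        (\<exists>\<alpha> \<beta> \<gamma> \<delta>. \<forall>x\<in>phase_space.
            kepler_family \<kappa> a x = kepler_P3 \<kappa> \<alpha> \<beta> x + kepler_P4 \<kappa> \<gamma> \<delta> x)" for a
    by (rule poisson_kepler_family_iff)
next
  fix a b B
  assume B: "B \<in> {kepler_P1 \<kappa> a b, kepler_P2 \<kappa> a, kepler_P3 \<kappa> a b, kepler_P4 \<kappa> a b}"
  then obtain c where c: "B = kepler_family \<kappa> c"
    using kepler_P1_eq_family kepler_P2_eq_family kepler_P3_eq_family kepler_P4_eq_family by blast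
  show "\<exists>c. \<forall>x\<in>phase_space. B x = kepler_family \<kappa> c x" using c by blast
  show "invariant_bivector_on phase_space (kepler_X \<kappa>) B" unfolding c by (rule invariant_kepler_family)
  show "poisson_on phase_space B" using B poisson_kepler_Ps by blast
next
  fix a b :: complex assume "b \<noteq> 0"
  then show "generic_rank_on phase_space (kepler_P1 \<kappa> a b) 4"
    by (intro generic_rank_4I skew_kepler_P1 open_phase_space dense_nondegenerate_P1)
next
  fix a :: complex assume "a \<noteq> 0"
  then show "generic_rank_on phase_space (kepler_P2 \<kappa> a) 4"
    by (intro generic_rank_4I skew_kepler_P2 open_phase_space dense_nondegenerate_P2)
next
  fix a b :: complex assume "(a, b) \<noteq> (0, 0)"
  then show "generic_rank_on phase_space (kepler_P3 \<kappa> a b) 2" "generic_rank_on phase_space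
      (kepler_P4 \<kappa> a b) 2"
    unfolding kepler_P3_eq_family kepler_P4_eq_family 
    using generic_rank_P34[of a 0 b \<kappa>] generic_rank_P34[of 0 a b \<kappa>] by auto
next
  fix a b x assume x: "x \<in> phase_space"
  show "bivector_apply (kepler_P1 \<kappa> a b) kepler_K3 x - (b - a * (\<i> * kepler_K1 \<kappa> x - kepler_K2 \<kappa> x))
            *s bivector_apply canonical_P kepler_K3 x = 0" by (rule kepler_P1_K3[OF x])
  show "2 *s bivector_apply (kepler_P3 \<kappa> a b) kepler_K3 x
          + (b * kepler_K3 x) *s bivector_apply canonical_P (kepler_H \<kappa>) x = 0"
    unfolding kepler_P3_eq_family by (rule kepler_P34_K3[OF x])
  show "2 *s bivector_apply (kepler_P4 \<kappa> a b) kepler_K3 x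
          + (b * kepler_K3 x) *s bivector_apply canonical_P (kepler_H \<kappa>) x = 0"
    unfolding kepler_P4_eq_family by (rule kepler_P34_K3[OF x])
next
  fix a x assume x: "x \<in> phase_space"
  show "bivector_apply (kepler_P2 \<kappa> a) kepler_K3 x
          - a *s (kepler_K3 x *s bivector_apply canonical_P (kepler_H \<kappa>) x
                  + (3 * kepler_H \<kappa> x) *s bivector_apply canonical_P kepler_K3 x) = 0"
    by (rule kepler_P2_K3[OF x])
next
  fix a b show "compatible_on phase_space canonical_P (kepler_P1 \<kappa> a b)" by (rule compatible_P1)
next
  fix a :: complex assume "a \<noteq> 0"
  then show "\<not> compatible_on phase_space canonical_P (kepler_P2 \<kappa> a)" by (rule not_compatible_P2)
next
  fix a b :: complex assume "(a, b) \<noteq> (0, 0)"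
  then show "\<not> compatible_on phase_space canonical_P (kepler_P3 \<kappa> a b)"
    "\<not> compatible_on phase_space canonical_P (kepler_P4 \<kappa> a b)"
    unfolding kepler_P3_eq_family kepler_P4_eq_family 
    using not_compatible_P34[of a 0 b \<kappa>] not_compatible_P34[of 0 a b \<kappa>] by auto
next
  show "nondegenerate_set phase_space canonical_P = phase_space" by (rule nondegenerate_canonical)
next
  fix B
  assume "B = canonical_P \<or> (\<exists>a b. b \<noteq> 0 \<and> B = kepler_P1 \<kappa> a b) \<or> (\<exists>a. a \<noteq> 0 \<and> B = kepler_P2 \<kappa> a)"
  \<comment> \<open>The three kinds of bivector are reduced to what they share: being Poisson
    members of the family with a dense nondegeneracy set.\<close>
  then have "(\<exists>c. B = kepler_family \<kappa> c) \<and> poisson_on phase_space B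
    \<and> phase_space \<subseteq> closure (nondegenerate_set phase_space B)"
  proof (elim disjE exE conjE)
    assume "B = canonical_P"
    then have B: "B = kepler_P1 \<kappa> 0 1" using canonical_eq_P1 by (rule trans)
    show ?thesis unfolding B
      by (intro conjI exI[where x
          = "P1_params 0 1"] kepler_P1_eq_family poisson_kepler_Ps dense_nondegenerate_P1) simp
  next
    fix a b assume b: "b \<noteq> 0" and B: "B = kepler_P1 \<kappa> a b"
    show ?thesis unfolding B
      by (intro conjI exI[where x
          = "P1_params a b"] kepler_P1_eq_family poisson_kepler_Ps dense_nondegenerate_P1 b)
  next
    fix a assume a: "a \<noteq> 0" and B: "B = kepler_P2 \<kappa> a"
    show ?thesis unfolding B
      by (intro conjI exI[where x
          = "P2_params a"] kepler_P2_eq_family poisson_kepler_Ps dense_nondegenerate_P2 a)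
  qed
  then obtain c where c: "B = kepler_family \<kappa> c" and poisson: "poisson_on phase_space B"
    and dense: "phase_space \<subseteq> closure (nondegenerate_set phase_space B)" by blast
  show "open (nondegenerate_set phase_space B)"
    using poisson open_phase_space by (intro open_nondegenerate_set) (simp_all add: poisson_on_def)
  show "phase_space \<subseteq> closure (nondegenerate_set phase_space B)" by (rule dense)
  show "symplectic_on (nondegenerate_set phase_space B) (inverse_form B)"
    "invariant_form_on (nondegenerate_set phase_space B) (kepler_X \<kappa>) (inverse_form B)"
    unfolding c by (rule inverse_form_kepler_family[OF poisson[unfolded c]])+
qed

end
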